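(* Every randomized one-pass streaming algorithm with constant error probability in the edge-arrival model that computes a $\frac{24}{25}$-maximal independent set of an $n$-vertex input graph requires space $n^{1+\Omega(\frac{1}{\log\log n})}$, and for every $\epsilon>0$, every such algorithm computing a $(1-\frac{1}{n^{\epsilon}})$-maximal independent set requires space $\Omega(n^{2-o(1)})$.
   Context: In the edge-arrival streaming model, the input graph $G$ on a predetermined vertex set of size $n$ is given as a sequence of its edges in arbitrary order, read once. For an $n$-vertex graph $G$, an independent set $I$ is $\delta$-maximal if $|I\cup\Gamma_G[I]|\ge \delta n$, where $\Gamma_G[I]$ denotes the set of neighbours of vertices of $I$. *)

theory Defs
  imports "HOL-Probability.Probability_Mass_Function" "HOL-Library.Ramsey"
begin

text \<open>
  An \<open>n\<close>-vertex graph has vertex set \<open>{..<n}\<close> and is given by its set of edges, a set of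
  two-element sets of vertices.
\<close>

definition graph_edges :: "nat \<Rightarrow> nat set set \<Rightarrow> bool" where
  "graph_edges n E \<longleftrightarrow> E \<subseteq> nsets {..<n} 2"

definition neighbours :: "nat set set \<Rightarrow> nat set \<Rightarrow> nat set" where
  "neighbours E I = {v. \<exists>u\<in>I. {u, v} \<in> E}"

definition independent_set :: "nat \<Rightarrow> nat set set \<Rightarrow> nat set \<Rightarrow> bool" where
  "independent_set n E I \<longleftrightarrow> I \<subseteq> {..<n} \<and> (\<forall>u\<in>I. \<forall>v\<in>I. {u, v} \<notin> E)"

definition delta_maximal_independent_set :: "real \<Rightarrow> nat \<Rightarrow> nat set set \<Rightarrow> nat set \<Rightarrow> bool" where
  "delta_maximal_independent_set \<delta> n E I \<longleftrightarrow>
     independent_set n E I \<and> real (card (I \<union> neighbours E I)) \<ge> \<delta> * real n"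

definition edge_stream :: "nat \<Rightarrow> nat set set \<Rightarrow> nat set list \<Rightarrow> bool" where
  "edge_stream n E es \<longleftrightarrow> graph_edges n E \<and> distinct es \<and> set es = E"

text \<open>
  The memory content of a streaming algorithm is a bit string. A randomized algorithm is a
  probability distribution over deterministic ones, so the random string is available throughout
  the computation and is not charged to the space. Algorithms that toss fresh coins at
  each step are covered: an edge occurs only once in a stream, so all the coins may be tossed in
  advance, independently for every pair of a memory content and an edge. Algorithms need not be
  uniform in \<open>n\<close>.
\<close>

record ('e, 'o) streaming_alg =
  init_memory :: "bool list"
  update_memory :: "bool list \<Rightarrow> 'e \<Rightarrow> bool list"
  result :: "bool list \<Rightarrow> 'o"

type_synonym ('e, 'o) randomized_streaming_alg = "('e, 'o) streaming_alg pmf"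

definition memory_after :: "('e, 'o) streaming_alg \<Rightarrow> 'e list \<Rightarrow> bool list" where
  "memory_after D es = foldl (update_memory D) (init_memory D) es"

definition computes_delta_maximal_independent_set ::
    "(nat set, nat set) randomized_streaming_alg \<Rightarrow> real \<Rightarrow> real \<Rightarrow> nat \<Rightarrow> bool" where
  "computes_delta_maximal_independent_set A p \<delta> n \<longleftrightarrow>
     (\<forall>E es. edge_stream n E es \<longrightarrow>
        measure_pmf.prob A {D. \<not> delta_maximal_independent_set \<delta> n E (result D (memory_after D es))} \<le> p)"

text \<open>
  Worst-case space in bits. Intermediate memory contents are accounted for, since every
  prefix of a stream of an \<open>n\<close>-vertex graph is a stream of an \<open>n\<close>-vertex graph.
\<close>

definition uses_space :: "(nat set, nat set) randomized_streaming_alg \<Rightarrow> nat \<Rightarrow> nat \<Rightarrow> bool" where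
  "uses_space A n s \<longleftrightarrow>
     (\<forall>D\<in>set_pmf A. \<forall>E es. edge_stream n E es \<longrightarrow> length (memory_after D es) \<le> s)"

definition requires_space :: "real \<Rightarrow> real \<Rightarrow> nat \<Rightarrow> real \<Rightarrow> bool" where
  "requires_space p \<delta> n b \<longleftrightarrow>
     (\<forall>A s. computes_delta_maximal_independent_set A p \<delta> n \<and> uses_space A n s \<longrightarrow> b \<le> real s)"

end

theory Submission
  imports Defs "HOL-Real_Asymp.Real_Asymp" "HOL-Number_Theory.Cong"
begin

text \<open>
  Take a bipartite graph whose edges split into \<open>t\<close> induced matchings of size \<open>r\<close> (a
  Ruzsa--Szemeredi graph) and stream two copies of the same random subgraph.  Afterwards choose a
  matching and join the vertices it leaves uncovered in the first copy completely to those it leaves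
  uncovered in the second.  An independent set then avoids the uncovered vertices of one copy, and
  there a vertex of the chosen matching can only be dominated by itself or by its partner.  Hence an
  almost maximal independent set contains both ends of almost every absent matching edge, and never
  both ends of a present one: it determines the \<open>r\<close> random bits of the matching up to few errors.  As the
  memory after the first phase does not depend on the chosen matching, counting the bit patterns compatible
  with a memory content shows that the space is of order \<open>t * r\<close>.

  The two bounds use two such graphs: one with matchings of linear size, given by translations of
  a power of a cyclic group along the words of a code (Fischer et al.; Goel, Kapralov and Khanna), and
  a dense one given by Behrend's sphere construction.
\<close>

section \<open>Counting\<close>

text \<open>Exponential moment bound in counting form. With weight \<open>L\<close> on every hit, a
  map with at least \<open>K\<close> hits weighs at least \<open>L powr K\<close>, and the total
  weight over the product set factorises into one sum per coordinate.\<close>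

lemma card_PiE_hits_le:
  fixes L K :: real
  assumes "finite I" "\<And>i. i \<in> I \<Longrightarrow> finite (F i)" "1 \<le> L"
  shows "real (card {x \<in> PiE I F. K \<le> real (card {i \<in> I. P i (x i)})}) * L powr K
       \<le> (\<Prod>i\<in>I. \<Sum>y\<in>F i. if P i y then L else 1)"
proof -
  let ?H = "{x \<in> PiE I F. K \<le> real (card {i \<in> I. P i (x i)})}"
  have fin: "finite (PiE I F)" using assms by (simp add: finite_PiE)
  have "real (card ?H) * L powr K = (\<Sum>x\<in>?H. L powr K)" by simp
  also have "\<dots> \<le> (\<Sum>x\<in>?H. \<Prod>i\<in>I. if P i (x i) then L else 1)"
  proof (rule sum_mono)
    fix x assume "x \<in> ?H"
    then have "L powr K \<le> L powr real (card {i \<in> I. P i (x i)})"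
      using assms(3) by (auto intro: powr_mono)
    also have "\<dots> = L ^ card {i \<in> I. P i (x i)}"
      using assms(3) by (simp add: powr_realpow)
    also have "\<dots> = (\<Prod>i\<in>I. if P i (x i) then L else 1)"
      using assms(1) by (simp add: prod.inter_filter[symmetric])
    finally show "L powr K \<le> (\<Prod>i\<in>I. if P i (x i) then L else 1)" .
  qed
  also have "\<dots> \<le> (\<Sum>x\<in>PiE I F. \<Prod>i\<in>I. if P i (x i) then L else 1)"
    using assms(3) by (intro sum_mono2 fin) (auto intro!: prod_nonneg)
  also have "\<dots> = (\<Prod>i\<in>I. \<Sum>y\<in>F i. if P i y then L else 1)"
    using assms(1,2) by (simp add: prod_sum_PiE)
  finally show ?thesis .
qed

section \<open>Hamming balls among bit patterns\<close>

definition bit_rows :: "nat \<Rightarrow> (nat \<Rightarrow> bool) set" where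
  "bit_rows r = (\<Pi>\<^sub>E a\<in>{..<r}. UNIV)"

lemma finite_bit_rows: "finite (bit_rows r)"
  by (simp add: bit_rows_def finite_PiE)

lemma card_bit_rows: "card (bit_rows r) = 2 ^ r"
  by (simp add: bit_rows_def card_PiE)

text \<open>
  The constant is the value of the exponential moment bound for Hamming balls of relative radius
  \<open>2/5\<close>, with weight \<open>3/2\<close> on every agreement.
\<close>

definition ball_density :: real where
  "ball_density = 5 / 4 * (2 / 3) powr (3 / 5)"

lemma ball_density: "0 < ball_density" "ball_density < 1"
proof -
  \<comment> \<open>Fifth powers clear the exponent and leave the rational comparison 8/27 <
    1024/3125.\<close>
  have "((2 / 3) powr (3 / 5) :: real) ^ 5 = (2 / 3) powr 3"
    by (simp add: powr_power)
  also have "\<dots> = (2 / 3) ^ 3"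
    by (simp add: powr_numeral)
  also have "\<dots> < (4 / 5 :: real) ^ 5"
    by (simp add: power_divide)
  finally have "(2 / 3) powr (3 / 5) < (4 / 5 :: real)"
    by (rule power_less_imp_less_base) simp
  then show "ball_density < 1" by (simp add: ball_density_def)
qed (simp add: ball_density_def)

text \<open>At most 2/5 disagreements means at least 3/5 agreements. Weight 3/2, which minimises the
  bound, gives every coordinate the sum 3/2 + 1 = 5/2.\<close>

lemma card_hamming_ball_le:
  "real (card {z \<in> bit_rows r. 5 * card {a \<in> {..<r}. y a \<noteq> z a} \<le> 2 * r})
     \<le> (2 * ball_density) ^ r"
proof -
  let ?B = "{z \<in> bit_rows r. 5 * card {a \<in> {..<r}. y a \<noteq> z a} \<le> 2 * r}"
  let ?C = "{z \<in> bit_rows r. 3 / 5 * real r \<le> real (card {a \<in> {..<r}. z a = y a})}"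
  have "?B \<subseteq> ?C"
  proof clarify
    fix z assume z: "5 * card {a \<in> {..<r}. y a \<noteq> z a} \<le> 2 * r"
    have "card {a \<in> {..<r}. z a = y a} + card {a \<in> {..<r}. y a \<noteq> z a}
        = card ({a \<in> {..<r}. z a = y a} \<union> {a \<in> {..<r}. y a \<noteq> z a})"
      by (subst card_Un_disjoint) auto
    also have "{a \<in> {..<r}. z a = y a} \<union> {a \<in> {..<r}. y a \<noteq> z a} = {..<r}" by auto
    finally show "3 / 5 * real r \<le> real (card {a \<in> {..<r}. z a = y a})" using z by simp
  qed
  then have "real (card ?B) \<le> real (card ?C)"
    by (intro of_nat_mono card_mono) (auto simp: finite_bit_rows)
  moreover have "real (card ?C) * (3 / 2) powr (3 / 5 * real r) \<le> (5 / 2) ^ r"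
  proof -
    have "real (card ?C) * (3 / 2) powr (3 / 5 * real r)
        \<le> (\<Prod>i\<in>{..<r}. \<Sum>z\<in>(UNIV::bool set). if z = y i then 3 / 2 else 1)"
      unfolding bit_rows_def by (rule card_PiE_hits_le) auto
    also have "\<dots> = (\<Prod>i\<in>{..<r}. 5 / 2)"
      by (intro prod.cong) (auto simp: UNIV_bool)
    finally show ?thesis by simp
  qed
  moreover have "(5 / 2) ^ r = (2 * ball_density) ^ r * (3 / 2) powr (3 / 5 * real r)"
  proof -
    have "((3 / 2 :: real) powr (3 / 5)) ^ r = (3 / 2) powr (3 / 5 * real r)"
      by (simp add: powr_power mult.commute)
    moreover have "2 * ball_density * (3 / 2) powr (3 / 5) = 5 / 2"
      by (simp add: ball_density_def powr_mult[symmetric])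
    ultimately show ?thesis by (metis power_mult_distrib)
  qed
  ultimately have "real (card ?B) * (3 / 2) powr (3 / 5 * real r)
      \<le> (2 * ball_density) ^ r * (3 / 2) powr (3 / 5 * real r)"
    by (metis (no_types, lifting) mult_right_mono order.trans powr_ge_zero)
  then show ?thesis
    by (rule mult_right_le_imp_le) simp
qed

text \<open>Each memory content fixes one guess per row, and only few inputs lie close to these
  guesses in a \<open>q / 2\<close> fraction of the rows. Since at least a \<open>q / 2\<close>
  fraction of all inputs is decoded that often, many memory contents are needed to account for
  them.\<close>

lemma one_way_communication_bound:
  fixes q :: real and t r :: nat and mem :: "(nat \<Rightarrow> nat \<Rightarrow> bool) \<Rightarrow> 'm"
  defines "X \<equiv> (\<Pi>\<^sub>E j\<in>{..<t}. bit_rows r)"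
  assumes q: "0 < q" and t: "0 < t" and fin: "finite S" and mem: "\<And>x. x \<in> X \<Longrightarrow> mem x \<in> S"
    and dec: "\<And>x j. x \<in> X \<Longrightarrow> j < t \<Longrightarrow> good x j \<Longrightarrow>
               5 * card {a \<in> {..<r}. out (mem x) j a \<noteq> x j a} \<le> 2 * r"
    and succ: "q * real t * real (card X) \<le> (\<Sum>x\<in>X. real (card {j \<in> {..<t}. good x j}))"
  shows "q / 2 \<le> real (card S) * 2 ^ t * ball_density powr (real r * (q / 2 * real t))"
proof -
  define K where "K = q / 2 * real t"
  \<comment> \<open>The weight of a hit is the inverse relative size of a Hamming ball. In each row
    the hits then contribute at most \<open>2 ^ r\<close>, no more than the unit weights do; this
    doubling is the source of the factor \<open>2 ^ t\<close>.\<close>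
  define L where "L = (1 / ball_density) ^ r"
  define hit where "hit m j z \<longleftrightarrow> 5 * card {a \<in> {..<r}. out m j a \<noteq> z a} \<le> 2 * r" for m j and z :: "nat \<Rightarrow> bool"
  define G where "G = {x \<in> X. K \<le> real (card {j \<in> {..<t}. good x j})}"
  define H where "H m = {x \<in> X. K \<le> real (card {j \<in> {..<t}. hit m j (x j)})}" for m
  have finX: "finite X" by (simp add: X_def finite_PiE finite_bit_rows)
  have cardX: "card X = (2 ^ r) ^ t" by (simp add: X_def card_PiE card_bit_rows)
  have L1: "1 \<le> L" unfolding L_def using ball_density by (intro one_le_power) simp
  \<comment> \<open>Reverse Markov inequality: an input outside \<open>G\<close> has fewer than
    \<open>K\<close> good rows, half of the average demanded by \<open>succ\<close>, and an input in
    \<open>G\<close> has at most \<open>t\<close>.\<close>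
  have "q / 2 * real (card X) \<le> real (card G)"
  proof -
    have "q * real t * real (card X) \<le> (\<Sum>x\<in>X. (if x \<in> G then real t else 0) + K)"
    proof (rule order.trans[OF succ], rule sum_mono)
      fix x assume "x \<in> X"
      have "card {j \<in> {..<t}. good x j} \<le> card {..<t}" by (intro card_mono) auto
      moreover have "0 \<le> K" using q by (simp add: K_def)
      ultimately show "real (card {j \<in> {..<t}. good x j}) \<le> (if x \<in> G then real t else 0) + K"
        using \<open>x \<in> X\<close> by (auto simp: G_def)
    qed
    also have "\<dots> = real t * real (card G) + K * real (card X)"
    proof -
      have "(\<Sum>x\<in>X. if x \<in> G then real t else 0) = (\<Sum>x\<in>X \<inter> G. real t)"
        by (rule sum.inter_restrict[OF finX, symmetric])
      moreover have "X \<inter> G = G" by (auto simp: G_def)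
      ultimately show ?thesis by (simp add: sum.distrib)
    qed
    finally have "real t * (q / 2 * real (card X)) \<le> real t * real (card G)"
      by (simp add: K_def algebra_simps)
    then show ?thesis using t by simp
  qed
  moreover have "G \<subseteq> (\<Union>m\<in>S. H m)"
  proof
    fix x assume x: "x \<in> G"
    then have xX: "x \<in> X" by (simp add: G_def)
    have "{j \<in> {..<t}. good x j} \<subseteq> {j \<in> {..<t}. hit (mem x) j (x j)}"
      using dec[OF xX] by (auto simp: hit_def)
    then have "card {j \<in> {..<t}. good x j} \<le> card {j \<in> {..<t}. hit (mem x) j (x j)}"
      by (intro card_mono) auto
    then have "x \<in> H (mem x)" using x by (auto simp: G_def H_def)
    then show "x \<in> (\<Union>m\<in>S. H m)" using mem[OF xX] by auto
  qed
  then have "card G \<le> card (\<Union>m\<in>S. H m)"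
    using finX fin by (intro card_mono) (auto simp: H_def)
  then have "real (card G) \<le> (\<Sum>m\<in>S. real (card (H m)))"
    using card_UN_le[OF fin, of H] by (metis (no_types) le_trans of_nat_mono of_nat_sum)
  moreover have "real (card (H m)) * L powr K \<le> (2 * 2 ^ r) ^ t" for m
  proof -
    have "real (card (H m)) * L powr K
        \<le> (\<Prod>j\<in>{..<t}. \<Sum>z\<in>bit_rows r. if hit m j z then L else 1)"
      unfolding H_def X_def using L1 by (intro card_PiE_hits_le) (auto simp: finite_bit_rows)
    also have "\<dots> \<le> (\<Prod>j\<in>{..<t}. 2 * 2 ^ r)"
    proof (rule prod_mono, rule conjI)
      fix j
      have "(\<Sum>z\<in>bit_rows r. if hit m j z then L else 1)
          \<le> (\<Sum>z\<in>bit_rows r. (if hit m j z then L else 0) + 1)"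
        using L1 by (intro sum_mono) auto
      also have "\<dots> = L * real (card {z \<in> bit_rows r. hit m j z}) + 2 ^ r"
        by (simp add: sum.distrib card_bit_rows sum.inter_filter[symmetric] finite_bit_rows)
      also have "\<dots> \<le> L * (2 * ball_density) ^ r + 2 ^ r"
        using card_hamming_ball_le[of r "out m j"] L1 by (simp add: hit_def)
      also have "L * (2 * ball_density) ^ r = 2 ^ r"
        using ball_density by (simp add: L_def power_mult_distrib power_one_over)
      finally show "(\<Sum>z\<in>bit_rows r. if hit m j z then L else 1) \<le> 2 * 2 ^ r" by simp
      show "0 \<le> (\<Sum>z\<in>bit_rows r. if hit m j z then L else 1)"
        using L1 by (intro sum_nonneg) auto
    qed
    finally show ?thesis by simp
  qed
  then have "real (card (H m)) \<le> (2 * 2 ^ r) ^ t / L powr K" for m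
    using L1 by (simp add: pos_le_divide_eq)
  then have "(\<Sum>m\<in>S. real (card (H m))) \<le> real (card S) * ((2 * 2 ^ r) ^ t / L powr K)"
    by (intro sum_bounded_above)
  ultimately have "q / 2 * real (card X) \<le> real (card S) * ((2 * 2 ^ r) ^ t / L powr K)"
    by linarith
  then have "q / 2 * (2 ^ r) ^ t \<le> real (card S) * 2 ^ t / L powr K * (2 ^ r) ^ t"
    unfolding cardX power_mult_distrib by (simp add: mult_ac)
  then have "q / 2 \<le> real (card S) * 2 ^ t / L powr K"
    by (rule mult_right_le_imp_le) simp
  moreover have "1 / L powr K = ball_density powr (real r * K)"
  proof -
    have "ball_density powr (real r * K) = (ball_density ^ r) powr K"
      using ball_density by (simp only: powr_powr[symmetric] powr_realpow)
    also have "ball_density ^ r = 1 / L"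
      by (simp add: L_def power_one_over)
    finally show ?thesis
      using L1 by (simp add: powr_divide)
  qed
  ultimately show ?thesis
    unfolding K_def[symmetric] by (metis mult.right_neutral times_divide_eq_right)
qed

section \<open>The hard instance\<close>

lemma doubleton_in_nsets: "u < n \<Longrightarrow> v < n \<Longrightarrow> u \<noteq> v \<Longrightarrow> {u, v} \<in> nsets {..<n} 2" for u v n :: nat
  by (simp add: nsets_def)

text \<open>A Ruzsa-Szemeredi graph with both sides \<open>{..<N}\<close>: \<open>lft j a\<close>
  and \<open>rgt j a\<close> are the ends of edge \<open>a\<close> of matching \<open>j\<close>. The
  axiom \<open>induced\<close> looks at an edge of any matching between vertices covered by matching
  \<open>j\<close>; its conclusion also makes the matchings edge-disjoint.\<close>

locale induced_matchings =
  fixes N t r :: nat and lft rgt :: "nat \<Rightarrow> nat \<Rightarrow> nat"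
  assumes lft_less: "j < t \<Longrightarrow> a < r \<Longrightarrow> lft j a < N"
    and rgt_less: "j < t \<Longrightarrow> a < r \<Longrightarrow> rgt j a < N"
    and inj_lft: "j < t \<Longrightarrow> inj_on (lft j) {..<r}"
    and inj_rgt: "j < t \<Longrightarrow> inj_on (rgt j) {..<r}"
    and induced: "\<lbrakk>i < t; j < t; a < r; b < r; c < r; lft i c = lft j a; rgt i c = rgt j b\<rbrakk>
      \<Longrightarrow> i = j \<and> a = b"
begin

text \<open>Four consecutive blocks of length \<open>N\<close> hold the two sides of both copies;
  the numbers from \<open>4 * N\<close> up to \<open>n\<close> remain isolated vertices.\<close>

definition vtx :: "nat \<Rightarrow> nat \<Rightarrow> nat" where
  "vtx k v = k * N + v"

lemma vtx_eq_iff: "v < N \<Longrightarrow> v' < N \<Longrightarrow> vtx k v = vtx k' v' \<longleftrightarrow> k = k' \<and> v = v'"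
  unfolding vtx_def
  by (metis add.commute add_left_cancel div_less div_mult_self1 gr_implies_not0 add_0)

lemma vtx_less: "k < 4 \<Longrightarrow> v < N \<Longrightarrow> 4 * N \<le> n \<Longrightarrow> vtx k v < n"
proof -
  assume "k < 4" "v < N" "4 * N \<le> n"
  then have "vtx k v < Suc k * N" by (simp add: vtx_def)
  also have "\<dots> \<le> 4 * N" using \<open>k < 4\<close> by (intro mult_right_mono) auto
  finally show ?thesis using \<open>4 * N \<le> n\<close> by simp
qed

text \<open>Copy \<open>c\<close> of the graph has the sides \<open>vtx (2 * c)\<close> and \<open>vtx (2 * c + 1)\<close>.\<close>

definition kept_edges :: "(nat \<Rightarrow> nat \<Rightarrow> bool) \<Rightarrow> nat set set" where
  "kept_edges x = {{vtx (2 * c) (lft j a), vtx (2 * c + 1) (rgt j a)} | c j a.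
     c < 2 \<and> j < t \<and> a < r \<and> x j a}"

definition uncovered :: "nat \<Rightarrow> nat \<Rightarrow> nat set" where
  "uncovered j c = vtx (2 * c) ` ({..<N} - lft j ` {..<r}) \<union>
     vtx (2 * c + 1) ` ({..<N} - rgt j ` {..<r})"

definition joining_edges :: "nat \<Rightarrow> nat set set" where
  "joining_edges j = {{u, v} | u v. u \<in> uncovered j 0 \<and> v \<in> uncovered j 1}"

lemma kept_edgesE:
  assumes "e \<in> kept_edges x"
  obtains c j a where "e = {vtx (2 * c) (lft j a), vtx (2 * c + 1) (rgt j a)}"
    "c < 2" "j < t" "a < r" "x j a"
  using assms unfolding kept_edges_def by blast

lemma uncoveredE:
  assumes "u \<in> uncovered j c"
  obtains (left) v where "u = vtx (2 * c) v" "v < N" "v \<notin> lft j ` {..<r}"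
    | (right) v where "u = vtx (2 * c + 1) v" "v < N" "v \<notin> rgt j ` {..<r}"
  using assms unfolding uncovered_def by blast

lemma vtx_lft_notin_uncovered:
  assumes "j < t" "a < r"
  shows "vtx (2 * c) (lft j a) \<notin> uncovered j d"
proof
  assume "vtx (2 * c) (lft j a) \<in> uncovered j d"
  then show False
    by (cases rule: uncoveredE) (use assms lft_less in \<open>auto simp: vtx_eq_iff\<close>, presburger)
qed

lemma vtx_rgt_notin_uncovered:
  assumes "j < t" "a < r"
  shows "vtx (2 * c + 1) (rgt j a) \<notin> uncovered j d"
proof
  assume "vtx (2 * c + 1) (rgt j a) \<in> uncovered j d"
  then show False
    by (cases rule: uncoveredE) (use assms rgt_less in \<open>auto simp: vtx_eq_iff\<close>, presburger)
qed

lemma graph_kept_edges: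
  assumes "4 * N \<le> n"
  shows "graph_edges n (kept_edges x)"
  unfolding graph_edges_def
proof
  fix e assume "e \<in> kept_edges x"
  then show "e \<in> nsets {..<n} 2"
  proof (cases rule: kept_edgesE)
    case (1 c j a)
    show ?thesis unfolding 1(1) using 1 assms lft_less rgt_less
      by (intro doubleton_in_nsets vtx_less) (auto simp: vtx_eq_iff)
  qed
qed

lemma uncovered_less: "4 * N \<le> n \<Longrightarrow> c < 2 \<Longrightarrow> u \<in> uncovered j c \<Longrightarrow> u < n"
  by (erule uncoveredE) (auto intro!: vtx_less)

lemma uncovered_disjoint: "u \<in> uncovered j 0 \<Longrightarrow> u \<notin> uncovered j 1"
  by (auto elim!: uncoveredE simp: vtx_eq_iff)

lemma graph_joining_edges:
  assumes "4 * N \<le> n"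
  shows "graph_edges n (joining_edges j)"
  unfolding graph_edges_def
proof
  fix e assume "e \<in> joining_edges j"
  then obtain u v where uv: "e = {u, v}" "u \<in> uncovered j 0" "v \<in> uncovered j 1"
    unfolding joining_edges_def by blast
  then show "e \<in> nsets {..<n} 2"
    using uncovered_less[OF assms, of 0 u j] uncovered_less[OF assms, of 1 v j]
      uncovered_disjoint[of u j]
    by (auto intro!: doubleton_in_nsets)
qed

text \<open>A kept edge stays within one copy, a joining edge runs between the copies. This is what
  lets the two phases be concatenated into one stream without repeated edges.\<close>

lemma kept_joining_disjoint: "kept_edges x \<inter> joining_edges j = {}"
proof -
  have False if "e \<in> kept_edges x" "e \<in> joining_edges j" for e
  proof -
    obtain c i a where e: "e = {vtx (2 * c) (lft i a), vtx (2 * c + 1) (rgt i a)}" "i < t" "a < r"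
      using \<open>e \<in> kept_edges x\<close> by (auto elim: kept_edgesE)
    obtain u v where uv: "e = {u, v}" "u \<in> uncovered j 0" "v \<in> uncovered j 1"
      using \<open>e \<in> joining_edges j\<close> unfolding joining_edges_def by blast
    have side: "w = vtx (2 * c) (lft i a) \<or> w = vtx (2 * c + 1) (rgt i a)" if "w \<in> {u, v}" for w
      using that e(1) uv(1) by auto
    have "d = c" if "w \<in> {u, v}" "w \<in> uncovered j d" for w d
      using that(2) side[OF that(1)] lft_less[OF e(2,3)] rgt_less[OF e(2,3)]
      by (cases rule: uncoveredE) (auto simp: vtx_eq_iff)
    from this[of u 0] this[of v 1] uv(2,3) show False by auto
  qed
  then show ?thesis by blast
qed

section \<open>Decoding the bits of a matching from an independent set\<close>

definition missed_copy :: "nat \<Rightarrow> nat set \<Rightarrow> nat" where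
  "missed_copy j I = (if I \<inter> uncovered j 0 = {} then 0 else 1)"

text \<open>Computed from the output alone, without access to \<open>x\<close>. Both ends of a
  present edge never lie in an independent set, so present edges are always reported correctly and
  errors are one-sided.\<close>

definition decode :: "nat \<Rightarrow> nat set \<Rightarrow> nat \<Rightarrow> bool" where
  "decode j I a \<longleftrightarrow> \<not> (vtx (2 * missed_copy j I) (lft j a) \<in> I
     \<and> vtx (2 * missed_copy j I + 1) (rgt j a) \<in> I)"

text \<open>The joining edges form a complete bipartite graph between the two uncovered sets, so an
  independent set that meets the one in copy 0 must avoid the one in copy 1.\<close>

lemma missed_copy:
  assumes "independent_set n (kept_edges x \<union> joining_edges j) I"
  shows "missed_copy j I < 2" "I \<inter> uncovered j (missed_copy j I) = {}"
proof -
  show "missed_copy j I < 2" by (simp add: missed_copy_def)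
  have "{u, v} \<in> joining_edges j" if "u \<in> uncovered j 0" "v \<in> uncovered j 1" for u v
    using that unfolding joining_edges_def by blast
  with assms show "I \<inter> uncovered j (missed_copy j I) = {}"
    unfolding missed_copy_def independent_set_def by (simp split: if_split) blast
qed

text \<open>Joining edges do not touch a vertex covered by matching \<open>j\<close>, so the
  dominating edge is a kept one. Its other end lies in \<open>I\<close>, hence is not uncovered and
  belongs to matching \<open>j\<close> as well; by inducedness the edge is the matching edge
  \<open>a\<close> itself.\<close>

lemma matched_neighbour:
  assumes j: "j < t" "a < r" and c: "I \<inter> uncovered j c = {}"
    and E: "E = kept_edges x \<union> joining_edges j"
  shows "vtx (2 * c) (lft j a) \<in> neighbours E I \<Longrightarrow> x j a"
    and "vtx (2 * c + 1) (rgt j a) \<in> neighbours E I \<Longrightarrow> x j a"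
proof -
  have edge: "\<exists>i b. i < t \<and> b < r \<and> x i b \<and>
      {u, w} = {vtx (2 * c) (lft i b), vtx (2 * c + 1) (rgt i b)}"
    if "{u, w} \<in> E" and w: "w \<in> {vtx (2 * c) (lft j a), vtx (2 * c + 1) (rgt j a)}" for u w
  proof -
    have "w \<notin> uncovered j d" for d
      using w vtx_lft_notin_uncovered[OF j] vtx_rgt_notin_uncovered[OF j] by blast
    then have "{u, w} \<notin> joining_edges j"
      unfolding joining_edges_def by (auto simp: doubleton_eq_iff)
    with that E have "{u, w} \<in> kept_edges x" by blast
    then obtain d i b where e: "{u, w} = {vtx (2 * d) (lft i b), vtx (2 * d + 1) (rgt i b)}"
      "i < t" "b < r" "x i b" by (auto elim: kept_edgesE)
    then have "w = vtx (2 * d) (lft i b) \<or> w = vtx (2 * d + 1) (rgt i b)" by blast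
    then have "d = c"
      using w lft_less rgt_less j e(2,3) by (auto simp: vtx_eq_iff)
    with e show ?thesis by blast
  qed
  show "x j a" if nb: "vtx (2 * c) (lft j a) \<in> neighbours E I"
  proof -
    obtain u where u: "u \<in> I" "{u, vtx (2 * c) (lft j a)} \<in> E"
      using nb unfolding neighbours_def by blast
    obtain i b where ib: "i < t" "b < r" "x i b"
      "{u, vtx (2 * c) (lft j a)} = {vtx (2 * c) (lft i b), vtx (2 * c + 1) (rgt i b)}"
      using edge[OF u(2)] by blast
    have ne: "vtx (2 * c) (lft j a) \<noteq> vtx (2 * c + 1) (rgt i b)"
      using ib j lft_less rgt_less by (simp add: vtx_eq_iff)
    then have "u = vtx (2 * c + 1) (rgt i b)" "vtx (2 * c) (lft j a) = vtx (2 * c) (lft i b)"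
      using ib(4) by (auto simp: doubleton_eq_iff)
    then have l: "lft i b = lft j a" and "vtx (2 * c + 1) (rgt i b) \<in> I"
      using ib j lft_less u(1) by (auto simp: vtx_eq_iff)
    then have "rgt i b \<in> rgt j ` {..<r}"
      using c rgt_less[OF ib(1,2)] unfolding uncovered_def by auto
    then obtain d where "d < r" "rgt i b = rgt j d" by auto
    then have "i = j" using induced[OF ib(1) j(1) j(2) _ ib(2) l] by blast
    then have "b = a" using inj_lft[OF j(1)] l ib(2) j(2) by (auto dest: inj_onD)
    with \<open>i = j\<close> ib(3) show ?thesis by simp
  qed
  show "x j a" if nb: "vtx (2 * c + 1) (rgt j a) \<in> neighbours E I"
  proof -
    obtain u where u: "u \<in> I" "{u, vtx (2 * c + 1) (rgt j a)} \<in> E"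
      using nb unfolding neighbours_def by blast
    obtain i b where ib: "i < t" "b < r" "x i b"
      "{u, vtx (2 * c + 1) (rgt j a)} = {vtx (2 * c) (lft i b), vtx (2 * c + 1) (rgt i b)}"
      using edge[OF u(2)] by blast
    have ne: "vtx (2 * c + 1) (rgt j a) \<noteq> vtx (2 * c) (lft i b)"
      using ib j lft_less rgt_less by (simp add: vtx_eq_iff)
    then have "u = vtx (2 * c) (lft i b)" "vtx (2 * c + 1) (rgt j a) = vtx (2 * c + 1) (rgt i b)"
      using ib(4) by (auto simp: doubleton_eq_iff)
    then have l: "rgt i b = rgt j a" and "vtx (2 * c) (lft i b) \<in> I"
      using ib j rgt_less u(1) by (auto simp: vtx_eq_iff)
    then have "lft i b \<in> lft j ` {..<r}"
      using c lft_less[OF ib(1,2)] unfolding uncovered_def by auto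
    then obtain d where "d < r" "lft i b = lft j d" by auto
    then have "i = j" using induced[OF ib(1) j(1) _ j(2) ib(2) _ l] by blast
    then have "b = a" using inj_rgt[OF j(1)] l ib(2) j(2) by (auto dest: inj_onD)
    with \<open>i = j\<close> ib(3) show ?thesis by simp
  qed
qed

text \<open>Every error is at an absent edge with an end outside \<open>I\<close>. That end has no
  neighbour in \<open>I\<close>, and at most \<open>(1 - \<delta>) * n\<close> vertices are
  undominated.\<close>

lemma decode_errors_le:
  assumes n: "4 * N \<le> n" and j: "j < t"
    and I: "delta_maximal_independent_set \<delta> n (kept_edges x \<union> joining_edges j) I"
  shows "real (card {a \<in> {..<r}. decode j I a \<noteq> x j a}) \<le> (1 - \<delta>) * real n"
proof -
  define E where "E = kept_edges x \<union> joining_edges j"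
  define c where "c = missed_copy j I"
  define U where "U = {..<n} - (I \<union> neighbours E I)"
  \<comment> \<open>\<open>h\<close> charges a wrongly decoded edge to one of its ends outside
    \<open>I\<close>; different matching edges share no vertex, so the charges are distinct.\<close>
  define h where "h a = (if vtx (2 * c) (lft j a) \<in> I
    then vtx (2 * c + 1) (rgt j a) else vtx (2 * c) (lft j a))" for a
  have ind: "independent_set n E I" and dom: "\<delta> * real n \<le> real (card (I \<union> neighbours E I))"
    using I unfolding E_def delta_maximal_independent_set_def by auto
  have c: "c < 2" "I \<inter> uncovered j c = {}"
    using missed_copy ind unfolding E_def c_def by auto
  have "E \<subseteq> nsets {..<n} 2"
    using graph_kept_edges[OF n] graph_joining_edges[OF n] unfolding E_def graph_edges_def by blast
  then have sub: "I \<union> neighbours E I \<subseteq> {..<n}"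
    using ind unfolding independent_set_def neighbours_def nsets_def by blast
  have "h ` {a \<in> {..<r}. decode j I a \<noteq> x j a} \<subseteq> U"
  proof clarify
    fix a assume a: "a < r" and err: "decode j I a \<noteq> x j a"
    have "{vtx (2 * c) (lft j a), vtx (2 * c + 1) (rgt j a)} \<in> E" if "x j a"
      unfolding E_def kept_edges_def using that a j c by blast
    then have "decode j I a" if "x j a"
      using that ind unfolding decode_def c_def independent_set_def by blast
    with err have x: "\<not> x j a" and dec: "decode j I a" by auto
    then have "vtx (2 * c) (lft j a) \<notin> neighbours E I" "vtx (2 * c + 1) (rgt j a) \<notin> neighbours E I"
      using matched_neighbour[OF j a c(2) E_def] by blast+
    moreover have "vtx (2 * c) (lft j a) < n" "vtx (2 * c + 1) (rgt j a) < n"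
      using c(1) n lft_less[OF j a] rgt_less[OF j a] by (auto intro!: vtx_less)
    ultimately show "h a \<in> U"
      using dec unfolding h_def U_def decode_def c_def by auto
  qed
  moreover have "inj_on h {a \<in> {..<r}. decode j I a \<noteq> x j a}"
  proof (rule inj_onI, clarify)
    fix a b assume ab: "a < r" "b < r" and "h a = h b"
    then have "lft j a = lft j b \<or> rgt j a = rgt j b"
      using lft_less[OF j] rgt_less[OF j] unfolding h_def by (auto simp: vtx_eq_iff split: if_splits)
    then show "a = b"
      using inj_lft[OF j] inj_rgt[OF j] ab by (auto dest: inj_onD)
  qed
  ultimately have "card {a \<in> {..<r}. decode j I a \<noteq> x j a} \<le> card U"
    by (intro card_inj_on_le[of h]) (auto simp: U_def)
  also have "card U = n - card (I \<union> neighbours E I)"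
    unfolding U_def using sub by (subst card_Diff_subset) (auto intro: finite_subset)
  finally have "card {a \<in> {..<r}. decode j I a \<noteq> x j a} + card (I \<union> neighbours E I) \<le> n"
    using card_mono[OF _ sub] by simp
  then show ?thesis using dom by (simp add: algebra_simps)
qed

end

section \<open>From induced matchings to space\<close>

lemma edge_stream_exists:
  assumes "graph_edges n E"
  shows "\<exists>es. edge_stream n E es"
proof -
  have "finite E"
    using assms finite_subset[OF _ finite_imp_finite_nsets[of "{..<n}" 2]]
    by (auto simp: graph_edges_def)
  then show ?thesis using assms finite_distinct_list unfolding edge_stream_def by blast
qed

lemma edge_stream_append:
  assumes "edge_stream n E es" "edge_stream n F fs" "E \<inter> F = {}"
  shows "edge_stream n (E \<union> F) (es @ fs)"
  using assms unfolding edge_stream_def graph_edges_def by auto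

lemma memory_after_append:
  "memory_after D (es @ fs) = foldl (update_memory D) (memory_after D es) fs"
  by (simp add: memory_after_def)

lemma card_memory_states_le:
  "finite {m :: bool list. length m \<le> s}" "card {m :: bool list. length m \<le> s} \<le> 2 ^ (s + 1)"
proof -
  show "finite {m :: bool list. length m \<le> s}"
    using finite_lists_length_le[of "UNIV :: bool set" s] by simp
  have "card {m :: bool list. length m \<le> s} = (\<Sum>i\<le>s. 2 ^ i)"
    using card_lists_length_le[of "UNIV :: bool set" s] by simp
  also have "\<dots> \<le> 2 ^ (s + 1)"
    by (induction s) auto
  finally show "card {m :: bool list. length m \<le> s} \<le> 2 ^ (s + 1)" .
qed

text \<open>Averaging over the instances fixes the coins of the algorithm.\<close>

lemma exists_coins_succeeding_often:
  fixes A :: "'d pmf" and q :: real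
  assumes "finite Y" "\<And>y. y \<in> Y \<Longrightarrow> q \<le> measure_pmf.prob A {D. P D y}"
  shows "\<exists>D\<in>set_pmf A. q * real (card Y) \<le> real (card {y \<in> Y. P D y})"
proof (rule ccontr)
  assume "\<not> ?thesis"
  then have less: "real (card {y \<in> Y. P D y}) < q * real (card Y)" if "D \<in> set_pmf A" for D
    using that by auto
  have count: "real (card {y \<in> Y. P D y}) = (\<Sum>y\<in>Y. indicator {D. P D y} D)" for D
  proof -
    have "{y \<in> Y. P D y} = Y \<inter> Collect (P D)" by auto
    then show ?thesis using assms(1) by (simp add: indicator_def)
  qed
  have int: "integrable (measure_pmf A) (\<lambda>D. \<Sum>y\<in>Y. indicator {D. P D y} D :: real)"
    by (intro Bochner_Integration.integrable_sum measure_pmf.integrable_const_bound[where B = 1]) auto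
  have "q * real (card Y) \<le> (\<Sum>y\<in>Y. measure_pmf.prob A {D. P D y})"
    using sum_mono[of Y "\<lambda>_. q" "\<lambda>y. measure_pmf.prob A {D. P D y}"] assms(2)
    by (simp add: mult.commute)
  also have "\<dots> = measure_pmf.expectation A (\<lambda>D. \<Sum>y\<in>Y. indicator {D. P D y} D)"
    by (subst Bochner_Integration.integral_sum)
       (auto intro!: measure_pmf.integrable_const_bound[where B = 1])
  finally have "0 \<le> measure_pmf.expectation A (\<lambda>D. (\<Sum>y\<in>Y. indicator {D. P D y} D) - q * real (card Y))"
    using int by (simp add: measure_pmf.prob_space)
  moreover have "measure_pmf.expectation A (\<lambda>D. q * real (card Y) - (\<Sum>y\<in>Y. indicator {D. P D y} D)) > 0"
  proof -
    have "AE D in measure_pmf A. 0 < q * real (card Y) - (\<Sum>y\<in>Y. indicator {D. P D y} D)"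
      using less by (auto simp: AE_measure_pmf_iff count[symmetric])
    moreover have "integrable (measure_pmf A) (\<lambda>D. q * real (card Y) - (\<Sum>y\<in>Y. indicator {D. P D y} D))"
      using int by auto
    ultimately show ?thesis
      using measure_pmf.expectation_greater[of A _ 0] by auto
  qed
  ultimately show False using int by (simp add: measure_pmf.prob_space)
qed

section \<open>Streaming algorithms as one-way protocols\<close>

context induced_matchings
begin

text \<open>The message is the memory after the kept edges. The receiver resumes the run on the
  joining edges for \<open>j\<close> and decodes the output; the condition on
  \<open>\<delta>\<close> keeps the undominated vertices within the tolerated
  \<open>2 / 5 * r\<close> errors.\<close>

lemma space_bound:
  assumes n: "4 * N \<le> n" and t: "0 < t" and p: "p < 1"
    and \<delta>: "5 * ((1 - \<delta>) * real n) \<le> 2 * real r"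
    and A: "computes_delta_maximal_independent_set A p \<delta> n" and s: "uses_space A n s"
  shows "(1 - p) / 2 \<le> 2 ^ (s + 1) * 2 ^ t * ball_density powr (real r * ((1 - p) / 2 * real t))"
proof -
  define X where "X = (\<Pi>\<^sub>E j\<in>{..<t}. bit_rows r)"
  \<comment> \<open>One stream order is fixed for each \<open>x\<close> and one for each
    \<open>j\<close>, so that the memory after \<open>es x\<close> is the same for all
    \<open>j\<close>.\<close>
  define es where "es x = (SOME es. edge_stream n (kept_edges x) es)" for x
  define fs where "fs j = (SOME fs. edge_stream n (joining_edges j) fs)" for j
  define good where "good D x j \<longleftrightarrow> delta_maximal_independent_set \<delta> n
    (kept_edges x \<union> joining_edges j) (result D (memory_after D (es x @ fs j)))" for D x j
  have es: "edge_stream n (kept_edges x) (es x)" for x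
    unfolding es_def using edge_stream_exists[OF graph_kept_edges[OF n]] by (rule someI_ex)
  have fs: "edge_stream n (joining_edges j) (fs j)" for j
    unfolding fs_def using edge_stream_exists[OF graph_joining_edges[OF n]] by (rule someI_ex)
  have stream: "edge_stream n (kept_edges x \<union> joining_edges j) (es x @ fs j)" for x j
    by (intro edge_stream_append es fs kept_joining_disjoint)
  have finX: "finite X" by (simp add: X_def finite_PiE finite_bit_rows)
  have "1 - p \<le> measure_pmf.prob A {D. good D x j}" for x j
  proof -
    have "measure_pmf.prob A {D. \<not> good D x j} \<le> p"
      using A stream unfolding computes_delta_maximal_independent_set_def good_def by blast
    moreover have "measure_pmf.prob A {D. \<not> good D x j} = 1 - measure_pmf.prob A {D. good D x j}"
      using measure_pmf.prob_compl[of "{D. good D x j}" A] by (simp add: Compl_eq_Diff_UNIV[symmetric] Collect_neg_eq)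
    ultimately show ?thesis by simp
  qed
  then obtain D where D: "D \<in> set_pmf A"
    and "(1 - p) * real (card (X \<times> {..<t})) \<le> real (card {y \<in> X \<times> {..<t}. good D (fst y) (snd y)})"
    using exists_coins_succeeding_often[of "X \<times> {..<t}" "1 - p" A "\<lambda>D y. good D (fst y) (snd y)"] finX
    by auto
  moreover have "card {y \<in> X \<times> {..<t}. good D (fst y) (snd y)} = (\<Sum>x\<in>X. card {j \<in> {..<t}. good D x j})"
  proof -
    have "{y \<in> X \<times> {..<t}. good D (fst y) (snd y)} = Sigma X (\<lambda>x. {j \<in> {..<t}. good D x j})" by auto
    then show ?thesis using finX by simp
  qed
  ultimately have succ: "(1 - p) * real t * real (card X) \<le> (\<Sum>x\<in>X. real (card {j \<in> {..<t}. good D x j}))"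
    by (simp add: card_cartesian_product mult_ac)
  define S where "S = {m :: bool list. length m \<le> s}"
  define out where "out m j = decode j (result D (foldl (update_memory D) m (fs j)))" for m j
  have "(1 - p) / 2 \<le> real (card S) * 2 ^ t * ball_density powr (real r * ((1 - p) / 2 * real t))"
  proof (rule one_way_communication_bound[where good = "good D" and out = out and mem = "\<lambda>x. memory_after D (es x)"])
    show "memory_after D (es x) \<in> S" for x
      using s D es unfolding uses_space_def S_def by blast
    show "5 * card {a \<in> {..<r}. out (memory_after D (es x)) j a \<noteq> x j a} \<le> 2 * r"
      if "j < t" "good D x j" for x j
    proof -
      have "real (card {a \<in> {..<r}. out (memory_after D (es x)) j a \<noteq> x j a}) \<le> (1 - \<delta>) * real n"
        using decode_errors_le[OF n \<open>j < t\<close>] that(2)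
        unfolding out_def good_def memory_after_append by blast
      with \<delta> have "real (5 * card {a \<in> {..<r}. out (memory_after D (es x)) j a \<noteq> x j a}) \<le> real (2 * r)"
        by simp
      then show ?thesis by (simp only: of_nat_le_iff)
    qed
    show "(1 - p) * real t * real (card ({..<t} \<rightarrow>\<^sub>E bit_rows r))
        \<le> (\<Sum>x\<in>{..<t} \<rightarrow>\<^sub>E bit_rows r. real (card {j \<in> {..<t}. good D x j}))"
      using succ by (simp add: X_def)
  qed (use p t card_memory_states_le in \<open>auto simp: S_def\<close>)
  also have "real (card S) \<le> 2 ^ (s + 1)"
    using of_nat_mono[OF card_memory_states_le(2)[of s], where 'a = real] by (simp add: S_def)
  finally show ?thesis by (simp add: mult_right_mono)
qed

end

text \<open>Logarithms in \<open>space_bound\<close> give a main term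
  \<open>2 * \<kappa> * r * t\<close> against \<open>s + 1 + t - log 2 q\<close>. Both
  \<open>\<kappa>\<close> and \<open>R\<close> depend only on \<open>p\<close>.\<close>

lemma requires_space_if_induced_matchings:
  assumes p: "0 \<le> p" "p < 1"
  obtains \<kappa> :: real and R :: nat where "0 < \<kappa>"
    "\<And>N t r lft rgt n \<delta>. \<lbrakk>induced_matchings N t r lft rgt; 4 * N \<le> n; 0 < t; R \<le> r;
       5 * ((1 - \<delta>) * real n) \<le> 2 * real r\<rbrakk> \<Longrightarrow> requires_space p \<delta> n (\<kappa> * real r * real t)"
proof -
  define q where "q = (1 - p) / 2"
  define g where "g = - log 2 ball_density"
  define \<kappa> where "\<kappa> = q * g / 2"
  \<comment> \<open>Chosen such that half of the main term, \<open>\<kappa> * r * t\<close>, is at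
    least \<open>(2 - log 2 q) * t\<close> and so absorbs \<open>1 + t - log 2 q\<close>.\<close>
  define R where "R = nat \<lceil>(2 - log 2 q) / \<kappa>\<rceil>"
  have q: "0 < q" "q \<le> 1" using p by (auto simp: q_def)
  have g: "0 < g" using ball_density by (simp add: g_def)
  have \<kappa>: "0 < \<kappa>" using q g by (simp add: \<kappa>_def)
  have "requires_space p \<delta> n (\<kappa> * real r * real t)"
    if "induced_matchings N t r lft rgt" "4 * N \<le> n" "0 < t" "R \<le> r" 
      "5 * ((1 - \<delta>) * real n) \<le> 2 * real r" for N t r lft rgt n \<delta>
    unfolding requires_space_def
  proof (intro allI impI, elim conjE)
    fix A s assume "computes_delta_maximal_independent_set A p \<delta> n" "uses_space A n s"
    then have "q \<le> 2 ^ (s + 1) * 2 ^ t * ball_density powr (real r * (q * real t))"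
      using induced_matchings.space_bound[OF that(1,2,3) p(2) that(5)] by (simp add: q_def)
    also have "\<dots> = 2 powr (real s + 1 + real t - g * (real r * (q * real t)))"
    proof -
      have "ball_density = 2 powr (- g)" using ball_density by (simp add: g_def)
      then have "ball_density powr (real r * (q * real t)) = 2 powr (- g * (real r * (q * real t)))"
        by (metis powr_powr)
      moreover have "(2::real) ^ (s + 1) = 2 powr (real s + 1)" "(2::real) ^ t = 2 powr (real t)"
        by (simp_all add: powr_realpow powr_add)
      ultimately show ?thesis by (simp add: powr_add[symmetric])
    qed
    finally have "log 2 q \<le> real s + 1 + real t - g * (real r * (q * real t))"
      using q by (simp add: log_le_iff)
    then have "2 * (\<kappa> * real r * real t) \<le> real s + 1 + real t - log 2 q"
      by (simp add: \<kappa>_def algebra_simps)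
    moreover have "1 + real t - log 2 q \<le> \<kappa> * real r * real t"
    proof -
      have "(2 - log 2 q) / \<kappa> \<le> real r" using \<open>R \<le> r\<close> unfolding R_def by linarith
      then have "2 - log 2 q \<le> \<kappa> * real r" using \<kappa> by (simp add: field_simps)
      then have "(2 - log 2 q) * real t \<le> \<kappa> * real r * real t" by (rule mult_right_mono) simp
      \<comment> \<open>The product is exactly the difference of \<open>(2 - log 2 q) * t\<close>
        and \<open>1 + t - log 2 q\<close>.\<close>
      moreover have "0 \<le> (1 - log 2 q) * (real t - 1)"
        using \<open>0 < t\<close> q by (intro mult_nonneg_nonneg) (auto simp: log_le_zero_cancel_iff intro: order.trans[of _ 0])
      ultimately show ?thesis by (simp add: algebra_simps)
    qed
    ultimately show "\<kappa> * real r * real t \<le> real s" by linarith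
  qed
  with \<kappa> that show ?thesis by blast
qed

section \<open>Graphs with many induced matchings\<close>

text \<open>Lets the constructions work with matchings as sets of pairs over arbitrary finite types:
  vertices and matchings get numbered, and \<open>r\<close> edges are picked from each matching.
  Inducedness is needed only for crossing pairs \<open>(x, y')\<close>.\<close>

lemma induced_matchings_of_sets:
  fixes M :: "'i \<Rightarrow> ('v \<times> 'v) set"
  assumes "finite V" "finite J"
    and sub: "\<And>i. i \<in> J \<Longrightarrow> M i \<subseteq> V \<times> V" and card: "\<And>i. i \<in> J \<Longrightarrow> r \<le> card (M i)"
    and fst: "\<And>i. i \<in> J \<Longrightarrow> inj_on fst (M i)" and snd: "\<And>i. i \<in> J \<Longrightarrow> inj_on snd (M i)"
    and ind: "\<And>i j x y x' y'. \<lbrakk>i \<in> J; j \<in> J; (x, y) \<in> M j; (x', y') \<in> M j; (x, y') \<in> M i\<rbrakk> \<Longrightarrow> i = j"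
  shows "\<exists>lft rgt. induced_matchings (card V) (card J) r lft rgt"
proof -
  obtain h where h: "bij_betw h V {..<card V}"
    using assms(1) ex_bij_betw_finite_nat by (metis atLeast0LessThan)
  obtain e where e: "bij_betw e {..<card J} J"
    using assms(2) ex_bij_betw_nat_finite by (metis atLeast0LessThan)
  have "\<exists>g. inj_on g {..<r} \<and> g ` {..<r} \<subseteq> M i" if "i \<in> J" for i
    using card_le_inj[of "{..<r}" "M i"] card[OF that] sub[OF that] \<open>finite V\<close>
    by (metis card_lessThan finite_SigmaI finite_lessThan finite_subset)
  then obtain g where g: "inj_on (g i) {..<r}" "g i ` {..<r} \<subseteq> M i" if "i \<in> J" for i
    by metis
  have eJ: "e j \<in> J" if "j < card J" for j
    using e that by (auto simp: bij_betw_def)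
  have gM: "g (e j) a \<in> M (e j)" if "j < card J" "a < r" for j a
    using g(2)[OF eJ[OF that(1)]] that(2) by auto
  have gV: "fst (g (e j) a) \<in> V" "snd (g (e j) a) \<in> V" if "j < card J" "a < r" for j a
    using gM[OF that] sub[OF eJ[OF that(1)]] by (auto simp: mem_Times_iff)
  have h_eq: "h u = h v \<longleftrightarrow> u = v" if "u \<in> V" "v \<in> V" for u v
    using h that by (auto simp: bij_betw_def dest: inj_onD)
  have h_less: "h u < card V" if "u \<in> V" for u
    using h that by (auto simp: bij_betw_def)
  have g_eq_fst: "a = b" if "j < card J" "a < r" "b < r" "fst (g (e j) a) = fst (g (e j) b)" for j a b
    using inj_onD[OF fst[OF eJ] that(4)] gM that inj_onD[OF g(1)[OF eJ]] by auto
  have g_eq_snd: "a = b" if "j < card J" "a < r" "b < r" "snd (g (e j) a) = snd (g (e j) b)" for j a b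
    using inj_onD[OF snd[OF eJ] that(4)] gM that inj_onD[OF g(1)[OF eJ]] by auto
  have "induced_matchings (card V) (card J) r (\<lambda>j a. h (fst (g (e j) a))) (\<lambda>j a. h (snd (g (e j) a)))"
  proof
    show "h (fst (g (e j) a)) < card V" "h (snd (g (e j) a)) < card V" if "j < card J" "a < r" for j a
      using gV[OF that] h_less by auto
    show "inj_on (\<lambda>a. h (fst (g (e j) a))) {..<r}" "inj_on (\<lambda>a. h (snd (g (e j) a))) {..<r}" if "j < card J" for j
      using that gV g_eq_fst g_eq_snd by (auto simp: inj_on_def h_eq)
    show "i = j \<and> a = b" if asm: "i < card J" "j < card J" "a < r" "b < r" "c < r"
      "h (fst (g (e i) c)) = h (fst (g (e j) a))" "h (snd (g (e i) c)) = h (snd (g (e j) b))" for i j a b c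
    proof -
      have eq: "fst (g (e i) c) = fst (g (e j) a)" "snd (g (e i) c) = snd (g (e j) b)"
        using asm gV h_eq by auto
      have "e i = e j"
        using ind[OF eJ[OF asm(1)] eJ[OF asm(2)], of "fst (g (e j) a)" "snd (g (e j) a)"
            "fst (g (e j) b)" "snd (g (e j) b)"] gM[OF asm(2,3)] gM[OF asm(2,4)] gM[OF asm(1,5)] eq
        by (metis prod.collapse)
      then have "i = j" using e asm(1,2) by (auto simp: bij_betw_def dest: inj_onD)
      then show ?thesis using eq g_eq_fst g_eq_snd asm by metis
    qed
  qed
  then show ?thesis by blast
qed

text \<open>Gilbert-Varshamov argument: the balls of words with at least \<open>d\<close> agreements
  around a maximal code cover all \<open>2 ^ (42 * d)\<close> words. Weight 128 on an agreement
  gives each coordinate at most 256, so a ball has at most \<open>2 ^ (41 * d)\<close>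
  words.\<close>

lemma code_with_few_agreements:
  obtains C where "C \<subseteq> (\<Pi>\<^sub>E i\<in>{..<6 * d}. {..<128::nat})" "2 ^ d \<le> card C"
    "\<And>f g. f \<in> C \<Longrightarrow> g \<in> C \<Longrightarrow> f \<noteq> g \<Longrightarrow> card {i \<in> {..<6 * d}. f i = g i} \<le> d"
proof -
  define W where "W = (\<Pi>\<^sub>E i\<in>{..<6 * d}. {..<128::nat})"
  define far where "far f g \<longleftrightarrow> card {i \<in> {..<6 * d}. f i = g i} \<le> d" for f g :: "nat \<Rightarrow> nat"
  define near where "near f = {g \<in> W. real d \<le> real (card {i \<in> {..<6 * d}. g i = f i})}" for f :: "nat \<Rightarrow> nat"
  have far_sym: "far f g \<longleftrightarrow> far g f" for f g
    by (simp add: far_def eq_commute)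
  have finW: "finite W" and cardW: "card W = 128 ^ (6 * d)"
    by (auto simp: W_def finite_PiE card_PiE)
  have near_le: "real (card (near f)) \<le> 64 ^ d * 128 ^ (5 * d)" for f
  proof -
    have "real (card (near f)) * 128 powr real d
        \<le> (\<Prod>i\<in>{..<6 * d}. \<Sum>y\<in>{..<128::nat}. if y = f i then 128 else 1)"
      unfolding near_def W_def by (rule card_PiE_hits_le) auto
    also have "\<dots> \<le> (\<Prod>i\<in>{..<6 * d}. 256)"
    proof (rule prod_mono, rule conjI)
      fix i
      have "(\<Sum>y\<in>{..<128::nat}. if y = f i then 128 else 1 :: real)
          \<le> (\<Sum>y\<in>{..<128::nat}. (if y = f i then 128 else 0) + 1)"
        by (intro sum_mono) auto
      also have "\<dots> \<le> 256" by (simp add: sum.distrib)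
      finally show "(\<Sum>y\<in>{..<128::nat}. if y = f i then 128 else 1 :: real) \<le> 256" .
    qed (auto intro!: sum_nonneg)
    also have "\<dots> = (64 ^ d * 128 ^ (5 * d)) * 128 powr real d"
      by (simp add: powr_realpow power_mult power_mult_distrib[symmetric])
    finally show ?thesis by (rule mult_right_le_imp_le) simp
  qed
  have "finite {C. C \<subseteq> W \<and> pairwise far C}" "{C. C \<subseteq> W \<and> pairwise far C} \<noteq> {}"
    using finW by (auto intro: exI[of _ "{}"])
  from finite_has_maximal[OF this] obtain C where C: "C \<subseteq> W" "pairwise far C"
    and max: "\<And>C'. C' \<subseteq> W \<Longrightarrow> pairwise far C' \<Longrightarrow> C \<subseteq> C' \<Longrightarrow> C = C'"
    by auto
  have finC: "finite C" using C(1) finW finite_subset by blast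
  have "W \<subseteq> (\<Union>f\<in>C. near f)"
  proof
    fix g assume g: "g \<in> W"
    show "g \<in> (\<Union>f\<in>C. near f)"
    proof (cases "g \<in> C")
      case True
      moreover have "g \<in> near g" using g by (simp add: near_def)
      ultimately show ?thesis by blast
    next
      case False
      then have "\<not> pairwise far (insert g C)" using max[of "insert g C"] g C(1) by blast
      then obtain f where "f \<in> C" "\<not> far g f"
        using C(2) far_sym by (auto simp: pairwise_insert)
      then show ?thesis using g by (force simp: near_def far_def)
    qed
  qed
  then have "card W \<le> card (\<Union>f\<in>C. near f)"
    using finC finW by (intro card_mono) (auto simp: near_def)
  also have "\<dots> \<le> (\<Sum>f\<in>C. card (near f))" using finC by (rule card_UN_le)
  finally have "real (card W) \<le> (\<Sum>f\<in>C. real (card (near f)))"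
    by (metis of_nat_mono of_nat_sum)
  also have "\<dots> \<le> real (card C) * (64 ^ d * 128 ^ (5 * d))"
    using near_le by (intro sum_bounded_above)
  finally have "2 ^ d * (64 ^ d * 128 ^ (5 * d)) \<le> real (card C) * (64 ^ d * 128 ^ (5 * d))"
    by (simp add: cardW power_mult power_mult_distrib[symmetric])
  then have "(2 :: real) ^ d \<le> real (card C)"
    by (rule mult_right_le_imp_le) simp
  then have "2 ^ d \<le> card C"
    by (metis of_nat_le_iff of_nat_numeral of_nat_power)
  moreover have "far f g" if "f \<in> C" "g \<in> C" "f \<noteq> g" for f g
    using C(2) that by (simp add: pairwise_def)
  ultimately show ?thesis using that[of C] C(1) unfolding W_def far_def by simp
qed

lemma card_rotation:
  assumes "k \<le> m"
  shows "card {\<theta> \<in> {..<m}. (\<theta> + s) mod m < k} = k"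
proof -
  have inj: "inj_on (\<lambda>\<theta>. (\<theta> + s) mod m) {..<m}"
    by (rule inj_onI) (metis cong_add_rcancel_nat cong_def lessThan_iff mod_less)
  have "(\<lambda>\<theta>. (\<theta> + s) mod m) ` {..<m} \<subseteq> {..<m}" by auto
  then have img: "(\<lambda>\<theta>. (\<theta> + s) mod m) ` {..<m} = {..<m}"
    using inj by (intro endo_inj_surj) auto
  have "(\<lambda>\<theta>. (\<theta> + s) mod m) ` {\<theta> \<in> {..<m}. (\<theta> + s) mod m < k} = {y \<in> (\<lambda>\<theta>. (\<theta> + s) mod m) ` {..<m}. y < k}"
    by auto
  also have "\<dots> = {..<k}" unfolding img using assms by auto
  finally have "card ((\<lambda>\<theta>. (\<theta> + s) mod m) ` {\<theta> \<in> {..<m}. (\<theta> + s) mod m < k}) = k" by simp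
  moreover have "inj_on (\<lambda>\<theta>. (\<theta> + s) mod m) {\<theta> \<in> {..<m}. (\<theta> + s) mod m < k}"
    using inj by (rule inj_on_subset) auto
  ultimately show ?thesis by (simp add: card_image)
qed

text \<open>Averaging over the offsets: each \<open>x\<close> falls into the window of width
  \<open>k\<close> for exactly \<open>k\<close> of the \<open>m\<close> rotations. This places the
  strip of each codeword so that it is at least of average size.\<close>

lemma exists_popular_rotation:
  fixes s :: "'a \<Rightarrow> nat"
  assumes "finite X" "k \<le> m" "0 < m"
  shows "\<exists>\<theta>. k * card X \<le> m * card {x \<in> X. (\<theta> + s x) mod m < k}"
proof (rule ccontr)
  assume "\<not> ?thesis"
  then have less: "m * card {x \<in> X. (\<theta> + s x) mod m < k} < k * card X" for \<theta>
    by (simp add: not_le)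
  have "(\<Sum>\<theta><m. card {x \<in> X. (\<theta> + s x) mod m < k}) = (\<Sum>x\<in>X. card {\<theta> \<in> {..<m}. (\<theta> + s x) mod m < k})"
    using sum.swap_restrict[of "{..<m}" X "\<lambda>_ _. 1::nat" "\<lambda>\<theta> x. (\<theta> + s x) mod m < k"] assms(1) by simp
  also have "\<dots> = k * card X" unfolding card_rotation[OF assms(2)] by simp
  finally have "m * (k * card X) = (\<Sum>\<theta><m. m * card {x \<in> X. (\<theta> + s x) mod m < k})"
    by (simp only: sum_distrib_left[symmetric])
  also have "\<dots> < (\<Sum>\<theta><m. k * card X)"
    using less \<open>0 < m\<close> by (intro sum_strict_mono) auto
  finally show False by simp
qed

text \<open>
  The vertices are \<open>h\<close> copies of the group of all maps from a \<open>6d \<times> 128\<close> grid to the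
  integers modulo \<open>12d\<close>.  A codeword \<open>f\<close> of length \<open>6d\<close> is identified with the indicator of its
  graph, a set of \<open>6d\<close> grid points.  Translation by \<open>f\<close> moves the sum over the graph of \<open>f\<close> by
  exactly \<open>6d\<close>, translation by another codeword moves it by at most \<open>d\<close>; hence the translations by
  \<open>f\<close> out of a strip of width \<open>5d\<close> form an induced matching.
\<close>

lemma linear_size_induced_matchings:
  fixes d h :: nat
  assumes d: "0 < d"
  defines "N \<equiv> (12 * d) ^ (768 * d) * h"
  obtains t lft rgt where "2 ^ d \<le> t" "induced_matchings N t (5 * N div 12) lft rgt"
proof -
  define m where "m = 12 * d"
  define Q where "Q = {..<6 * d} \<times> {..<128::nat}"
  define X where "X = (\<Pi>\<^sub>E p\<in>Q. {..<m})"
  define V where "V = X \<times> {..<h}"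
  define S where "S f x = (\<Sum>i<6 * d. x (i, f i))" for f :: "nat \<Rightarrow> nat" and x :: "nat \<times> nat \<Rightarrow> nat"
  define tr where "tr f x = (\<lambda>p\<in>Q. (x p + (if f (fst p) = snd p then 1 else 0)) mod m)"
    for f :: "nat \<Rightarrow> nat" and x :: "nat \<times> nat \<Rightarrow> nat"
  obtain C where C: "C \<subseteq> (\<Pi>\<^sub>E i\<in>{..<6 * d}. {..<128::nat})" and card_C: "2 ^ d \<le> card C"
    and far: "\<And>f g. f \<in> C \<Longrightarrow> g \<in> C \<Longrightarrow> f \<noteq> g \<Longrightarrow> card {i \<in> {..<6 * d}. f i = g i} \<le> d"
    by (rule code_with_few_agreements[of d]) blast
  have finX: "finite X" by (simp add: X_def Q_def finite_PiE)
  have m: "0 < m" using d by (simp add: m_def)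
  have cardX: "card X = (12 * d) ^ (768 * d)"
    by (simp add: X_def Q_def m_def card_PiE card_cartesian_product)
  have card_V: "card V = N" by (simp add: V_def card_cartesian_product cardX N_def)
  have "\<exists>\<theta>. 5 * d * card X \<le> m * card {x \<in> X. (\<theta> + S f x) mod m < 5 * d}" for f
    using finX m by (intro exists_popular_rotation) (auto simp: m_def)
  then have "\<exists>\<theta>. \<forall>f. 5 * d * card X \<le> m * card {x \<in> X. (\<theta> f + S f x) mod m < 5 * d}"
    by (intro choice allI)
  then obtain \<theta> where \<theta>: "\<And>f. 5 * d * card X \<le> m * card {x \<in> X. (\<theta> f + S f x) mod m < 5 * d}"
    by blast
  define red where "red f = {x \<in> X. (\<theta> f + S f x) mod m < 5 * d}" for f
  define M where "M f = (\<lambda>(x, k). ((x, k), (tr f x, k))) ` (red f \<times> {..<h})" for f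
  have S_tr: "(\<theta>' + S f (tr g x)) mod m = ((\<theta>' + S f x) mod m + card {i \<in> {..<6 * d}. f i = g i}) mod m"
    if "f \<in> C" for f g x \<theta>'
  proof -
    have "(i, f i) \<in> Q" if "i < 6 * d" for i
      using that \<open>f \<in> C\<close> C by (auto simp: Q_def)
    then have "S f (tr g x) = (\<Sum>i<6 * d. (x (i, f i) + (if f i = g i then 1 else 0)) mod m)"
      unfolding S_def tr_def by (intro sum.cong) auto
    then have "S f (tr g x) mod m = (\<Sum>i<6 * d. x (i, f i) + (if f i = g i then 1 else 0)) mod m"
      by (simp only: mod_sum_eq)
    also have "(\<Sum>i<6 * d. x (i, f i) + (if f i = g i then 1 else 0)) = S f x + card {i \<in> {..<6 * d}. f i = g i}"
      by (simp add: S_def sum.distrib sum.inter_filter[symmetric])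
    finally have "(\<theta>' + S f (tr g x)) mod m = (\<theta>' + (S f x + card {i \<in> {..<6 * d}. f i = g i})) mod m"
      by (rule mod_add_cong[OF refl])
    then show ?thesis by (simp only: mod_add_left_eq add.assoc)
  qed
  have tr_X: "tr f x \<in> X" for f x using m by (auto simp: tr_def X_def)
  have tr_inj: "x = x'" if "x \<in> X" "x' \<in> X" "tr f x = tr f x'" for f x x'
  proof (rule PiE_ext)
    show "x \<in> (\<Pi>\<^sub>E p\<in>Q. {..<m})" "x' \<in> (\<Pi>\<^sub>E p\<in>Q. {..<m})" using that by (auto simp: X_def)
    fix p assume p: "p \<in> Q"
    with that have "x p < m" "x' p < m" by (auto simp: X_def)
    moreover have "tr f x p = tr f x' p" using that by simp
    ultimately show "x p = x' p"
      using p by (auto simp: tr_def mod_Suc split: if_splits)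
  qed
  \<comment> \<open>The strip has width \<open>5 * d\<close> out of \<open>12 * d\<close>, hence the
    density 5/12.\<close>
  have "5 * N div 12 \<le> card (M f)" for f
  proof -
    have "card (M f) = card (red f) * h"
      unfolding M_def by (subst card_image) (auto simp: inj_on_def card_cartesian_product)
    moreover have "d * (5 * card X) \<le> d * (12 * card (red f))"
      using \<theta>[of f] by (simp add: red_def m_def mult_ac)
    then have "5 * card X * h \<le> 12 * card (red f) * h" using d by (intro mult_right_mono) auto
    ultimately have "5 * N \<le> 12 * card (M f)" by (simp add: N_def cardX mult_ac)
    then show ?thesis by linarith
  qed
  moreover have "finite V" "finite C"
    using finX C finite_subset[OF C] by (auto simp: V_def finite_PiE)
  moreover have "M f \<subseteq> V \<times> V" for f
    using tr_X by (auto simp: M_def V_def red_def)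
  moreover have "inj_on fst (M f)" "inj_on snd (M f)" for f
    using tr_inj by (auto simp: M_def inj_on_def red_def)
  moreover have "g = f" if fg: "g \<in> C" "f \<in> C" and edges: "(u, v) \<in> M f" "(u', v') \<in> M f" "(u, v') \<in> M g" for f g u v u' v'
  proof (rule ccontr)
    assume "g \<noteq> f"
    obtain x x' where x: "x \<in> red f" "x' \<in> red f" "tr g x = tr f x'"
      using edges by (auto simp: M_def)
    define y where "y = (\<theta> f + S f x) mod m"
    define y' where "y' = (\<theta> f + S f x') mod m"
    have y: "y < 5 * d" "y' < 5 * d" using x by (auto simp: red_def y_def y'_def)
    have "(y + card {i \<in> {..<6 * d}. f i = g i}) mod m = (y' + card {i \<in> {..<6 * d}. f i = f i}) mod m"
      using S_tr[OF fg(2), of "\<theta> f" g x] S_tr[OF fg(2), of "\<theta> f" f x'] x(3)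
      by (simp only: y_def y'_def)
    moreover have "card {i \<in> {..<6 * d}. f i = g i} \<le> d"
      using far[OF fg(2,1)] \<open>g \<noteq> f\<close> by auto
    \<comment> \<open>Leaving the strip of \<open>f\<close> along \<open>g\<close> ends at a residue
      below \<open>6 * d\<close>, leaving it along \<open>f\<close> at one from \<open>6 * d\<close>
      to below \<open>11 * d\<close>. With modulus \<open>12 * d\<close> there is no wrap-around, so
      the two cannot meet.\<close>
    ultimately show False using y by (simp add: m_def)
  qed
  ultimately have "\<exists>lft rgt. induced_matchings (card V) (card C) (5 * N div 12) lft rgt"
    by (intro induced_matchings_of_sets[where M = M]) blast+
  then show ?thesis using that card_C card_V by blast
qed

text \<open>Pigeonhole: the squared norm of a grid point takes at most \<open>k * b\<^sup>2\<close>
  values.\<close>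

lemma large_sphere:
  fixes b k :: nat
  assumes "0 < k" "0 < b"
  obtains v where "b ^ k \<le> card {x \<in> \<Pi>\<^sub>E i\<in>{..<k}. {..<b}. (\<Sum>i<k. (x i)\<^sup>2) = v} * (k * b\<^sup>2)"
proof -
  define J where "J = (\<Pi>\<^sub>E i\<in>{..<k}. {..<b})"
  have finJ: "finite J" by (simp add: J_def finite_PiE)
  have "(\<Sum>i<k. (x i)\<^sup>2) \<in> {..<k * b\<^sup>2}" if "x \<in> J" for x
  proof -
    have "(\<Sum>i<k. (x i)\<^sup>2) < (\<Sum>i<k. b\<^sup>2)"
      using that \<open>0 < k\<close> by (intro sum_strict_mono power_strict_mono) (auto simp: J_def)
    then show ?thesis by simp
  qed
  then have "(\<lambda>x. \<Sum>i<k. (x i)\<^sup>2) ` J \<subseteq> {..<k * b\<^sup>2}" by blast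
  then have "card J = (\<Sum>v<k * b\<^sup>2. card {x \<in> J. (\<Sum>i<k. (x i)\<^sup>2) = v})"
    using sum.group[of J "{..<k * b\<^sup>2}" "\<lambda>x. \<Sum>i<k. (x i)\<^sup>2" "\<lambda>_. 1::nat"] finJ by simp
  moreover have "\<exists>v. card J \<le> card {x \<in> J. (\<Sum>i<k. (x i)\<^sup>2) = v} * (k * b\<^sup>2)"
  proof (rule ccontr)
    assume "\<not> ?thesis"
    then have "card {x \<in> J. (\<Sum>i<k. (x i)\<^sup>2) = v} * (k * b\<^sup>2) < card J" for v by (simp add: not_le)
    then have "(\<Sum>v<k * b\<^sup>2. card {x \<in> J. (\<Sum>i<k. (x i)\<^sup>2) = v} * (k * b\<^sup>2)) < (\<Sum>v<k * b\<^sup>2. card J)"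
      using assms by (intro sum_strict_mono) (auto simp: lessThan_empty_iff)
    then show False
      unfolding sum_distrib_right[symmetric] calculation[symmetric] by simp
  qed
  ultimately obtain v where "card J \<le> card {x \<in> J. (\<Sum>i<k. (x i)\<^sup>2) = v} * (k * b\<^sup>2)"
    by blast
  moreover have "card J = b ^ k" by (simp add: J_def card_PiE)
  ultimately show ?thesis using that[of v] by (simp add: J_def)
qed

text \<open>Parallelogram law: if \<open>y\<close> is the midpoint of \<open>x\<close> and
  \<open>z\<close> and all three have the same norm, then the squared distance of \<open>x\<close>
  and \<open>z\<close> vanishes.\<close>

lemma sphere_midpoint:
  fixes x y z :: "nat \<Rightarrow> nat"
  assumes "\<And>i. i < k \<Longrightarrow> x i + z i = 2 * y i"
    and "(\<Sum>i<k. (x i)\<^sup>2) = v" "(\<Sum>i<k. (y i)\<^sup>2) = v" "(\<Sum>i<k. (z i)\<^sup>2) = v" and "i < k"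
  shows "x i = y i" "z i = y i"
proof -
  have "(\<Sum>i<k. (int (x i) - int (z i))\<^sup>2) = (\<Sum>i<k. 2 * int ((x i)\<^sup>2) + 2 * int ((z i)\<^sup>2) - 4 * int ((y i)\<^sup>2))"
  proof (rule sum.cong)
    fix i assume "i \<in> {..<k}"
    then have "int (x i) + int (z i) = 2 * int (y i)" using assms(1)[of i] by simp
    then have "(int (x i) + int (z i))\<^sup>2 = 4 * (int (y i))\<^sup>2" by (simp add: power_mult_distrib)
    then show "(int (x i) - int (z i))\<^sup>2 = 2 * int ((x i)\<^sup>2) + 2 * int ((z i)\<^sup>2) - 4 * int ((y i)\<^sup>2)"
      by (simp add: power2_eq_square algebra_simps)
  qed simp
  also have "\<dots> = 2 * int (\<Sum>i<k. (x i)\<^sup>2) + 2 * int (\<Sum>i<k. (z i)\<^sup>2) - 4 * int (\<Sum>i<k. (y i)\<^sup>2)"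
    by (simp only: sum_subtractf sum.distrib sum_distrib_left[symmetric] of_nat_sum)
  also have "\<dots> = 0" using assms(2-4) by simp
  finally have "int (x i) - int (z i) = 0"
    using \<open>i < k\<close> by (subst (asm) sum_nonneg_eq_0_iff) auto
  then show "x i = y i" "z i = y i" using assms(1)[OF \<open>i < k\<close>] by auto
qed

text \<open>
  Behrend's construction, left in the grid: a sphere contains no three points in arithmetic
  progression, so the pairs \<open>(x + a, x + 2a)\<close> with \<open>a\<close> on the sphere form an induced matching.
\<close>

lemma dense_induced_matchings:
  fixes b k :: nat
  assumes "0 < k" "0 < b"
  obtains r lft rgt where "b ^ k \<le> r * (k * b\<^sup>2)"
    "induced_matchings ((3 * b) ^ k) (b ^ k) r lft rgt"
proof -
  define J where "J = (\<Pi>\<^sub>E i\<in>{..<k}. {..<b})"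
  \<comment> \<open>Side \<open>3 * b\<close> leaves room for \<open>x + 2 * a\<close> with entries
    of \<open>x\<close> and \<open>a\<close> below \<open>b\<close>.\<close>
  define V where "V = (\<Pi>\<^sub>E i\<in>{..<k}. {..<3 * b})"
  obtain v where v: "b ^ k \<le> card {x \<in> J. (\<Sum>i<k. (x i)\<^sup>2) = v} * (k * b\<^sup>2)"
    using large_sphere[OF assms] unfolding J_def by blast
  define A where "A = {x \<in> J. (\<Sum>i<k. (x i)\<^sup>2) = v}"
  define tr where "tr c x a = (\<lambda>i\<in>{..<k}. x i + c * a i)" for c :: nat and x a :: "nat \<Rightarrow> nat"
  define M where "M x = (\<lambda>a. (tr 1 x a, tr 2 x a)) ` A" for x
  have J_less: "x i < b" if "x \<in> J" "i < k" for x i using that by (auto simp: J_def)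
  have A_J: "a \<in> J" if "a \<in> A" for a using that by (simp add: A_def)
  have J_ext: "x = y" if "x \<in> J" "y \<in> J" "\<And>i. i < k \<Longrightarrow> x i = y i" for x y
    using that unfolding J_def by (intro PiE_ext[of x "{..<k}"]) auto
  have tr_V: "tr c x a \<in> V" if "c = 1 \<or> c = 2" "x \<in> J" "a \<in> J" for c x a
  proof -
    have "x i + c * a i < 3 * b" if "i < k" for i
      using \<open>c = 1 \<or> c = 2\<close> J_less[OF \<open>x \<in> J\<close> that] J_less[OF \<open>a \<in> J\<close> that] by auto
    then show ?thesis by (auto simp: tr_def V_def)
  qed
  have tr_app: "tr c x a i = x i + c * a i" if "i < k" for c x a i using that by (simp add: tr_def)
  have tr_inj: "a = a'" if "a \<in> A" "a' \<in> A" "tr c x a = tr c x a'" "0 < c" for c x a a'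
  proof (rule J_ext)
    fix i assume "i < k"
    with fun_cong[OF that(3), of i] that(4) show "a i = a' i" by (simp add: tr_app)
  qed (use that A_J in auto)
  have inj: "inj_on (\<lambda>a. (tr 1 x a, tr 2 x a)) A" for x
    using tr_inj[of _ _ 1] by (auto simp: inj_on_def)
  have "card A \<le> card (M x)" for x
    unfolding M_def using inj by (simp add: card_image)
  moreover have "finite V" "finite J" by (auto simp: V_def J_def finite_PiE)
  moreover have "M x \<subseteq> V \<times> V" if "x \<in> J" for x
    using tr_V that A_J by (auto simp: M_def)
  moreover have "inj_on fst (M x)" "inj_on snd (M x)" for x
    using tr_inj[of _ _ 1 x] tr_inj[of _ _ 2 x] by (auto simp: M_def inj_on_def)
  moreover have "z = x" if zx: "z \<in> J" "x \<in> J" and edges: "(u, w) \<in> M x" "(u', w') \<in> M x" "(u, w') \<in> M z" for z x u w u' w'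
  proof -
    obtain a where a: "a \<in> A" "u = tr 1 x a" using edges(1) by (auto simp: M_def)
    obtain a' where a': "a' \<in> A" "w' = tr 2 x a'" using edges(2) by (auto simp: M_def)
    obtain c where c: "c \<in> A" "u = tr 1 z c" "w' = tr 2 z c" using edges(3) by (auto simp: M_def)
    have e1: "x i + a i = z i + c i" and e2: "x i + 2 * a' i = z i + 2 * c i" if "i < k" for i
      using fun_cong[OF trans[OF a(2)[symmetric] c(2)], of i]
        fun_cong[OF trans[OF a'(2)[symmetric] c(3)], of i] that by (auto simp: tr_app)
    \<comment> \<open>Eliminating \<open>x\<close> and \<open>z\<close> makes \<open>a'\<close> the
      midpoint of \<open>a\<close> and \<open>c\<close>, all three on the sphere.\<close>
    have "a i + c i = 2 * a' i" if "i < k" for i using e1[OF that] e2[OF that] by linarith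
    then have "a i = a' i" "c i = a' i" if "i < k" for i
      using sphere_midpoint[of k a c a' v i] that a(1) a'(1) c(1) by (auto simp: A_def)
    then show "z = x" using e1 zx by (intro J_ext) auto
  qed
  ultimately have "\<exists>lft rgt. induced_matchings (card V) (card J) (card A) lft rgt"
    by (intro induced_matchings_of_sets[where M = M]) blast+
  then obtain lft rgt where "induced_matchings (card V) (card J) (card A) lft rgt"
    by blast
  then show ?thesis using that[of "card A" lft rgt] v by (simp add: V_def J_def A_def card_PiE)
qed

section \<open>The space bounds\<close>

lemma requires_space_mono: "requires_space p \<delta> n b \<Longrightarrow> b' \<le> b \<Longrightarrow> requires_space p \<delta> n b'"
  unfolding requires_space_def by (meson order.trans)

text \<open>With \<open>d\<close> about \<open>L n / 1000\<close> the group has at most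
  \<open>n powr (96 / 125)\<close> elements, so copies of it fill almost a quarter of
  \<open>n\<close>. Then \<open>r\<close> is at least \<open>n / 10\<close>, just enough for 24/25,
  and \<open>t\<close> is at least \<open>2 ^ d\<close>.\<close>

lemma space_for_constant_fraction:
  assumes p: "0 \<le> p" "p < 1"
  shows "\<forall>\<^sub>F n in sequentially.
           requires_space p (24 / 25) n (real n powr (1 + 1 / 4000 / ln (ln (real n))))"
proof -
  obtain \<kappa> R where \<kappa>: "0 < \<kappa>" and space: "\<And>N t r lft rgt n \<delta>.
      \<lbrakk>induced_matchings N t r lft rgt; 4 * N \<le> n; 0 < t; R \<le> r;
       5 * ((1 - \<delta>) * real n) \<le> 2 * real r\<rbrakk> \<Longrightarrow> requires_space p \<delta> n (\<kappa> * real r * real t)"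
    using requires_space_if_induced_matchings[OF p] by blast
  define L where "L n = ln (real n) / ln (ln (real n))" for n :: nat
  have L: "filterlim L at_top sequentially"
    unfolding L_def by real_asymp
  \<comment> \<open>The number of matchings yields \<open>exp (L n / 2000) / 2\<close>; half of this
    exponent is given up to absorb the constant factor \<open>\<kappa> / 20\<close>.\<close>
  have "filterlim (\<lambda>l::real. \<kappa> / 20 * exp (l / 4000)) at_top at_top"
    using \<kappa> by real_asymp
  then have "\<forall>\<^sub>F l in at_top. 1 \<le> \<kappa> / 20 * exp (l / 4000)"
    unfolding filterlim_at_top by blast
  then have "\<forall>\<^sub>F n in sequentially. 1 \<le> \<kappa> / 20 * exp (L n / 4000)"
    by (rule eventually_compose_filterlim[OF _ L])
  moreover have "\<forall>\<^sub>F n in sequentially. 1000 \<le> L n"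
    using L by (simp add: filterlim_at_top)
  moreover have "\<forall>\<^sub>F n in sequentially. 1 \<le> ln (ln (real n))"
    by real_asymp
  moreover have "\<forall>\<^sub>F n in sequentially. 400 * real n powr (96 / 125) \<le> real n"
    by real_asymp
  \<comment> \<open>320 pays for the rounding in \<open>r\<close>, and \<open>10 * R\<close> ensures
    \<open>R \<le> r\<close> once \<open>n \<le> 10 * r\<close> is known.\<close>
  moreover have "\<forall>\<^sub>F n in sequentially. 320 + 10 * R \<le> n"
    by (rule eventually_ge_at_top)
  ultimately show ?thesis
  proof eventually_elim
    fix n :: nat
    assume big: "1 \<le> \<kappa> / 20 * exp (L n / 4000)" and L1000: "1000 \<le> L n"
      and lnln: "1 \<le> ln (ln (real n))" and pow: "400 * real n powr (96 / 125) \<le> real n"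
      and nR: "320 + 10 * R \<le> n"
    define w where "w = ln (ln (real n))"
    have w: "1 \<le> w" and Lw: "L n = ln (real n) / w" using lnln by (simp_all only: w_def L_def)
    define d where "d = nat \<lfloor>L n / 1000\<rfloor>"
    define P where "P = (12 * d) ^ (768 * d)"
    \<comment> \<open>As many copies as fit when all four blocks together must stay within
      \<open>n\<close> vertices.\<close>
    define h where "h = n div (4 * P)"
    define r where "r = 5 * (P * h) div 12"
    have n0: "0 < real n" using nR by simp
    have d_le: "real d \<le> L n / 1000" and d_ge: "L n / 1000 - 1 \<le> real d" and d0: "0 < d"
      using L1000 unfolding d_def by linarith+
    have lnn: "0 < ln (real n)" using L1000 w unfolding Lw
      by (smt (verit) divide_nonpos_pos)
    have "400 * real P \<le> real n"
    proof -
      have "L n \<le> ln (real n)"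
        using divide_left_mono[OF w, of "ln (real n)"] w lnn unfolding Lw by simp
      then have "12 * real d \<le> ln (real n)" using d_le lnn by simp
      then have "real P \<le> ln (real n) ^ (768 * d)"
        using power_mono[of "real (12 * d)" "ln (real n)" "768 * d"] unfolding P_def of_nat_power
        by simp
      also have "\<dots> = exp (real (768 * d) * w)"
        using lnn unfolding w_def by (metis exp_ln exp_of_nat_mult)
      also have "\<dots> \<le> exp (96 / 125 * ln (real n))"
      proof -
        have "real d * w \<le> L n / 1000 * w"
          using d_le w by (intro mult_right_mono) auto
        also have "\<dots> = ln (real n) / 1000" using w by (simp add: Lw)
        finally show ?thesis by (simp add: mult_ac)
      qed
      also have "\<dots> = real n powr (96 / 125)" using n0 by (simp add: powr_def)
      finally show ?thesis using pow by simp
    qed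
    then have "real (400 * P) \<le> real n" by simp
    then have P: "400 * P \<le> n" by (simp only: of_nat_le_iff)
    have P0: "0 < P" using d0 by (simp add: P_def)
    have h: "4 * (P * h) \<le> n"
      using div_times_less_eq_dividend[of n "4 * P"] by (simp add: h_def mult_ac)
    have "n < 4 * (P * h) + 4 * P"
      using dividend_less_times_div[of "4 * P" n] P0 by (simp add: h_def mult_ac)
    with P have "99 * n \<le> 400 * (P * h)" by linarith
    then have r: "n \<le> 10 * r" unfolding r_def using nR by linarith
    obtain t lft rgt where t: "2 ^ d \<le> t" "induced_matchings (P * h) t r lft rgt"
      using linear_size_induced_matchings[OF d0, of h] unfolding P_def r_def by blast
    have "0 < t" using t(1) by (metis gr0I le_zero_eq power_not_zero zero_neq_numeral)
    have "requires_space p (24 / 25) n (\<kappa> * real r * real t)"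
      using h \<open>0 < t\<close> r nR by (intro space[OF t(2)]) auto
    moreover have "real n powr (1 + 1 / 4000 / w) \<le> \<kappa> * real r * real t"
    proof -
      have "real n powr (1 + 1 / 4000 / w) = real n * exp (L n / 4000)"
        using n0 by (simp add: powr_add powr_def[of "real n" "1 / (w * 4000)"] Lw mult.commute)
      also have "\<dots> \<le> real n * (exp (L n / 4000) * (\<kappa> / 20 * exp (L n / 4000)))"
        using mult_left_mono[OF big, of "exp (L n / 4000)"] n0 by (intro mult_left_mono) auto
      also have "\<dots> = \<kappa> * (real n / 10) * (exp (L n / 2000) / 2)"
        by (simp add: exp_add[symmetric])
      also have "\<dots> \<le> \<kappa> * real r * real t"
      proof (intro mult_mono)
        have "exp (L n / 2000) \<le> exp (ln 2 * (L n / 1000))"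
          using mult_right_mono[of "1 / 2" "ln 2" "L n / 1000"] ln2_ge_two_thirds L1000 by simp
        also have "\<dots> \<le> exp (ln 2 * (real d + 1))"
          using d_ge by simp
        also have "\<dots> = 2 * 2 ^ d"
          by (simp add: distrib_left exp_add exp_of_nat2_mult)
        also have "\<dots> \<le> 2 * real t"
          using of_nat_mono[OF t(1), where 'a = real] by simp
        finally show "exp (L n / 2000) / 2 \<le> real t" by simp
      qed (use \<kappa> r in auto)
      finally show ?thesis .
    qed
    ultimately show "requires_space p (24 / 25) n (real n powr (1 + 1 / 4000 / ln (ln (real n))))"
      unfolding w_def[symmetric] by (rule requires_space_mono)
  qed
qed

text \<open>Write \<open>n\<close> as 2 to the power \<open>y\<^sup>2\<close>. Behrend's graph with
  dimension about \<open>y\<close> and side about \<open>2 powr y\<close> loses only exponents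
  linear in \<open>y\<close>: 6 in \<open>t\<close>, 9 in \<open>r\<close>, hence
  \<open>15 / y\<close> in the exponent of \<open>n\<close>.\<close>

lemma space_for_almost_all:
  assumes p: "0 \<le> p" "p < 1" and \<epsilon>: "0 < \<epsilon>"
  shows "\<exists>C>0. \<forall>\<^sub>F n in sequentially. requires_space p (1 - 1 / real n powr \<epsilon>) n
           (C * real n powr (2 - 15 / sqrt (log 2 (real n))))"
proof -
  obtain \<kappa> R where \<kappa>: "0 < \<kappa>" and space: "\<And>N t r lft rgt n \<delta>.
      \<lbrakk>induced_matchings N t r lft rgt; 4 * N \<le> n; 0 < t; R \<le> r;
       5 * ((1 - \<delta>) * real n) \<le> 2 * real r\<rbrakk> \<Longrightarrow> requires_space p \<delta> n (\<kappa> * real r * real t)"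
    using requires_space_if_induced_matchings[OF p] by blast
  define y where "y n = sqrt (log 2 (real n))" for n :: nat
  have y: "filterlim y at_top sequentially"
    unfolding y_def by real_asymp
  have "\<forall>\<^sub>F z in at_top. real R \<le> 2 powr (z\<^sup>2 - 9 * z)"
    by real_asymp
  then have "\<forall>\<^sub>F n in sequentially. real R \<le> 2 powr ((y n)\<^sup>2 - 9 * y n)"
    by (rule eventually_compose_filterlim[OF _ y])
  \<comment> \<open>This makes \<open>n powr (1 - \<epsilon>)\<close>, the allowed number of
    undominated vertices, at most a quarter of the lower bound for \<open>r\<close>.\<close>
  moreover have "\<forall>\<^sub>F z in at_top. 9 * z + 2 \<le> \<epsilon> * z\<^sup>2"
    using \<epsilon> by real_asymp
  then have "\<forall>\<^sub>F n in sequentially. 9 * y n + 2 \<le> \<epsilon> * (y n)\<^sup>2"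
    by (rule eventually_compose_filterlim[OF _ y])
  moreover have "\<forall>\<^sub>F n in sequentially. 4 \<le> y n"
    using y by (simp add: filterlim_at_top)
  moreover have "\<forall>\<^sub>F n in sequentially. 2 \<le> n"
    by (rule eventually_ge_at_top)
  ultimately have "\<forall>\<^sub>F n in sequentially. requires_space p (1 - 1 / real n powr \<epsilon>) n
      (\<kappa> * real n powr (2 - 15 / y n))"
  proof eventually_elim
    fix n :: nat
    assume R: "real R \<le> 2 powr ((y n)\<^sup>2 - 9 * y n)"
      and small: "9 * y n + 2 \<le> \<epsilon> * (y n)\<^sup>2"
      and y4: "4 \<le> y n" and n2: "2 \<le> n"
    have n: "real n = 2 powr ((y n)\<^sup>2)" using n2 by (simp add: y_def)
    \<comment> \<open>Subtracting 2 gives \<open>k + 1 \<le> y n - 1\<close>, so that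
      \<open>4 * (4 * b) ^ k\<close>, with exponent \<open>(k + 1)\<^sup>2 + 1\<close>, is still at
      most \<open>n\<close>.\<close>
    define k where "k = nat \<lfloor>y n\<rfloor> - 2"
    define b :: nat where "b = 2 ^ k"
    have k: "0 < k" "real k \<le> y n - 2" "y n - 3 \<le> real k"
      using y4 unfolding k_def by linarith+
    obtain r lft rgt where r: "b ^ k \<le> r * (k * b\<^sup>2)"
      and M: "induced_matchings ((3 * b) ^ k) (b ^ k) r lft rgt"
      using dense_induced_matchings[of k b] k(1) by (auto simp: b_def)
    have rb: "real b = 2 powr real k" by (simp add: b_def powr_realpow)
    have bk: "real (b ^ k) = 2 powr (real k)\<^sup>2"
      by (simp add: rb powr_power power2_eq_square)
    have "(y n)\<^sup>2 - 6 * y n \<le> (real k)\<^sup>2"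
    proof -
      have "(y n - 3)\<^sup>2 \<le> (real k)\<^sup>2" using k y4 by (intro power_mono) auto
      then show ?thesis by (simp add: power2_eq_square algebra_simps)
    qed
    then have t_ge: "2 powr ((y n)\<^sup>2 - 6 * y n) \<le> real (b ^ k)" unfolding bk by simp
    have r_ge: "2 powr ((y n)\<^sup>2 - 9 * y n) \<le> real r"
    proof -
      have "b ^ k \<le> r * (b * b\<^sup>2)"
      proof -
        have "k \<le> b" unfolding b_def by (simp add: less_imp_le)
        then show ?thesis using r by (meson le_trans mult_le_mono1 mult_le_mono2)
      qed
      then have "real (b ^ k) \<le> real (r * (b * b\<^sup>2))" by (rule of_nat_mono)
      also have "\<dots> = real r * 2 powr (3 * real k)"
      proof -
        have "real b * (real b)\<^sup>2 = real b ^ 3" by (simp add: power2_eq_square power3_eq_cube)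
        also have "\<dots> = 2 powr (3 * real k)" by (simp add: rb powr_power mult.commute)
        finally show ?thesis by simp
      qed
      also have "\<dots> \<le> real r * 2 powr (3 * y n)"
        using k by (intro mult_left_mono) auto
      finally have "2 powr ((y n)\<^sup>2 - 9 * y n) * 2 powr (3 * y n) \<le> real r * 2 powr (3 * y n)"
        using t_ge by (simp add: powr_add[symmetric])
      then show ?thesis by (rule mult_right_le_imp_le) simp
    qed
    have "4 * (3 * b) ^ k \<le> n"
    proof -
      have "real (4 * (3 * b) ^ k) \<le> 4 * (4 * real b) ^ k"
        by (simp add: power_mult_distrib power_mono mult_right_mono)
      also have "\<dots> = 2 powr (2 + 2 * real k + (real k)\<^sup>2)"
      proof -
        have "(4 :: real) ^ k = 2 powr (2 * real k)"
          using powr_power[of "2 :: real" 2 k] by (simp add: mult.commute)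
        then show ?thesis
          using bk by (simp add: power_mult_distrib powr_add)
      qed
      also have "\<dots> \<le> 2 powr ((y n)\<^sup>2)"
      proof -
        have "(real k + 1)\<^sup>2 \<le> (y n - 1)\<^sup>2" using k by (intro power_mono) auto
        then show ?thesis using y4 by (simp add: power2_eq_square algebra_simps)
      qed
      finally show ?thesis unfolding n[symmetric] by (simp only: of_nat_le_iff)
    qed
    moreover have "5 * ((1 - (1 - 1 / real n powr \<epsilon>)) * real n) \<le> 2 * real r"
    proof -
      have "(1 - (1 - 1 / real n powr \<epsilon>)) * real n = 2 powr ((y n)\<^sup>2 - \<epsilon> * (y n)\<^sup>2)"
        unfolding n by (simp add: powr_diff powr_powr mult.commute)
      moreover have "4 * 2 powr ((y n)\<^sup>2 - \<epsilon> * (y n)\<^sup>2) \<le> 2 powr ((y n)\<^sup>2 - 9 * y n)"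
      proof -
        have "4 * 2 powr ((y n)\<^sup>2 - \<epsilon> * (y n)\<^sup>2) = 2 powr (2 + ((y n)\<^sup>2 - \<epsilon> * (y n)\<^sup>2))"
          by (simp only: powr_add) simp
        also have "\<dots> \<le> 2 powr ((y n)\<^sup>2 - 9 * y n)"
          using small by (intro powr_mono) auto
        finally show ?thesis .
      qed
      ultimately show ?thesis using r_ge powr_ge_zero[of 2 "(y n)\<^sup>2 - \<epsilon> * (y n)\<^sup>2"] by linarith
    qed
    moreover have "R \<le> r" using R r_ge by linarith
    ultimately have "requires_space p (1 - 1 / real n powr \<epsilon>) n (\<kappa> * real r * real (b ^ k))"
      by (intro space[OF M]) (auto simp: b_def)
    moreover have "\<kappa> * real n powr (2 - 15 / y n) \<le> \<kappa> * real r * real (b ^ k)"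
    proof -
      have "(y n)\<^sup>2 * (2 - 15 / y n) = ((y n)\<^sup>2 - 9 * y n) + ((y n)\<^sup>2 - 6 * y n)"
        using y4 by (simp add: power2_eq_square algebra_simps)
      then have "real n powr (2 - 15 / y n) = 2 powr ((y n)\<^sup>2 - 9 * y n) * 2 powr ((y n)\<^sup>2 - 6 * y n)"
        unfolding n by (simp only: powr_powr powr_add)
      also have "\<dots> \<le> real r * real (b ^ k)"
        using r_ge t_ge by (intro mult_mono) auto
      finally show ?thesis using \<kappa> by (simp add: mult.assoc)
    qed
    ultimately show "requires_space p (1 - 1 / real n powr \<epsilon>) n (\<kappa> * real n powr (2 - 15 / y n))"
      by (rule requires_space_mono)
  qed
  then show ?thesis using \<kappa> unfolding y_def by blast
qed

theorem theorem5:
  fixes p :: real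
  assumes "0 \<le> p" and "p < 1"
  shows "(\<exists>c>0. \<forall>\<^sub>F n in sequentially.
            requires_space p (24 / 25) n (real n powr (1 + c / ln (ln (real n))))) \<and>
         (\<forall>\<epsilon>>0. \<exists>f :: nat \<Rightarrow> real. f \<longlonglongrightarrow> 0 \<and> (\<exists>C>0. \<forall>\<^sub>F n in sequentially.
            requires_space p (1 - 1 / real n powr \<epsilon>) n (C * real n powr (2 - f n))))"
proof (intro conjI allI impI)
  show "\<exists>c>0. \<forall>\<^sub>F n in sequentially.
      requires_space p (24 / 25) n (real n powr (1 + c / ln (ln (real n))))"
    using space_for_constant_fraction[OF assms] by (intro exI[of _ "1 / 4000"]) simp
next
  fix \<epsilon> :: real assume "0 < \<epsilon>"
  have "(\<lambda>n. 15 / sqrt (log 2 (real n))) \<longlonglongrightarrow> 0"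
    by real_asymp
  then show "\<exists>f :: nat \<Rightarrow> real. f \<longlonglongrightarrow> 0 \<and> (\<exists>C>0. \<forall>\<^sub>F n in sequentially.
      requires_space p (1 - 1 / real n powr \<epsilon>) n (C * real n powr (2 - f n)))"
    using space_for_almost_all[OF assms \<open>0 < \<epsilon>\<close>] by blast
qed

end
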